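(* Let $\nu>0$, $0<\kappa<1$, $S>0$ and $\Xi>0$ be arbitrarily fixed. Then for any choice of $\sigma\in\mathbb{R}$ with $$-\frac{\tau_{++}}{\tau_{+-}}\,\exp\bigl(-(\mu_+-\mu_-)\,\Xi\bigr)\;\le\;\sigma\;\le\;-\frac{\tau_{-+}}{\tau_{--}}\,\exp\bigl(+(\mu_+-\mu_-)\,\Xi\bigr)$$ there exists a unique solution $V$ of the traveling wave problem (with parameters $\nu,\kappa,S,\Xi$) whose coefficients satisfy $$B_-=\sigma\,B_+,\qquad B_+>0.$$ This solution is strictly positive on $\mathbb{R}$ and also satisfies $$A_-\ge 0,\qquad C_+\ge 0.$$ Moreover, other solutions do not exist, i.e. every solution of the traveling wave problem with parameters $\nu,\kappa,S,\Xi$ is obtained in this way for some $\sigma$ in the stated range.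
   Context: Background: one considers increasing traveling waves $u(t,x)=U(x+St)$, $S>0$, of $\partial_t u-\nu^2\partial_x^2\partial_t u=\partial_x^2\Phi'(u)$, where $\Phi'(u)=u+1$ for $u\le-\kappa$, $\Phi'(u)=-\frac{1-\kappa}{\kappa}u$ for $-\kappa\le u\le\kappa$, $\Phi'(u)=u-1$ for $u\ge\kappa$. The function $V$ is the derivative $U'$ of a profile with $U(\pm\Xi)=\pm\kappa$. Intervals: $I_-=(-\infty,-\Xi]$, $I_0=[-\Xi,\Xi]$, $I_+=[\Xi,\infty)$. Exponential rates: $$\lambda_\pm=-\frac{1}{2\nu^2S}\pm\sqrt{\Bigl(\frac{1}{2\nu^2S}\Bigr)^2+\frac1{\nu^2}},\qquad \mu_\pm=\frac{1-\kappa}{2\nu^2S\kappa}\pm\sqrt{\Bigl(\frac{1-\kappa}{2\nu^2S\kappa}\Bigr)^2+\frac1{\nu^2}}.$$ Auxiliary quantities: $$\tau_{--}=-\lambda_-+\mu_--\tfrac{1}{\nu^2S\kappa},\quad \tau_{-+}=-\lambda_-+\mu_+-\tfrac{1}{\nu^2S\kappa},\quad \tau_{+-}=-\lambda_++\mu_--\tfrac{1}{\nu^2S\kappa},\quad \tau_{++}=-\lambda_++\mu_+-\tfrac{1}{\nu^2S\kappa}.$$ Traveling wave problem (with parameters $\nu,\kappa,S,\Xi$): a solution is a continuous function $V:\mathbb{R}\to\mathbb{R}$ that satisfies $$S\,V-\nu^2S\,V''=\bigl(V-c\,V\bigr)'$$ in the weak (distributional) sense on $\mathbb{R}$, where $c(X)=1/\kappa$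 for $X\in I_0$ and $c(X)=0$ otherwise, and that satisfies the constraints $V(X)\ge0$ for all $X\in\mathbb{R}$ and $\int_{-\Xi}^{\Xi}V(X)\,dX=2\kappa$. Equivalently to the weak equation, $V$ is continuous, has the form $$V(X)=\begin{cases}A_-e^{\lambda_-X}+A_+e^{\lambda_+X}&X\in I_-,\\ B_-e^{\mu_-X}+B_+e^{\mu_+X}&X\in I_0,\\ C_-e^{\lambda_-X}+C_+e^{\lambda_+X}&X\in I_+,\end{cases}$$ with real coefficients $A_\pm,B_\pm,C_\pm$, and the one-sided derivatives satisfy $V'(-\Xi-0)=V'(-\Xi+0)-\frac{1}{\nu^2S\kappa}V(-\Xi)$ and $V'(\Xi+0)=V'(\Xi-0)-\frac{1}{\nu^2S\kappa}V(\Xi)$. The coefficients $A_\pm,B_\pm,C_\pm$ in the claim are those of this representation. *)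

theory Defs
  imports "HOL-Analysis.Analysis"
begin

definition lambda_minus :: "real \<Rightarrow> real \<Rightarrow> real" where
  "lambda_minus \<nu> S = - (1 / (2 * \<nu>\<^sup>2 * S)) - sqrt ((1 / (2 * \<nu>\<^sup>2 * S))\<^sup>2 + 1 / \<nu>\<^sup>2)"

definition lambda_plus :: "real \<Rightarrow> real \<Rightarrow> real" where
  "lambda_plus \<nu> S = - (1 / (2 * \<nu>\<^sup>2 * S)) + sqrt ((1 / (2 * \<nu>\<^sup>2 * S))\<^sup>2 + 1 / \<nu>\<^sup>2)"

definition mu_minus :: "real \<Rightarrow> real \<Rightarrow> real \<Rightarrow> real" where
  "mu_minus \<nu> \<kappa> S =
     (1 - \<kappa>) / (2 * \<nu>\<^sup>2 * S * \<kappa>) - sqrt (((1 - \<kappa>) / (2 * \<nu>\<^sup>2 * S * \<kappa>))\<^sup>2 + 1 / \<nu>\<^sup>2)"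

definition mu_plus :: "real \<Rightarrow> real \<Rightarrow> real \<Rightarrow> real" where
  "mu_plus \<nu> \<kappa> S =
     (1 - \<kappa>) / (2 * \<nu>\<^sup>2 * S * \<kappa>) + sqrt (((1 - \<kappa>) / (2 * \<nu>\<^sup>2 * S * \<kappa>))\<^sup>2 + 1 / \<nu>\<^sup>2)"

text \<open>In the following names the first letter (\<open>m\<close> for minus, \<open>p\<close> for plus) refers to
  \<open>\<lambda>\<close> and the second one to \<open>\<mu>\<close>.\<close>

definition tau_mm :: "real \<Rightarrow> real \<Rightarrow> real \<Rightarrow> real" where
  "tau_mm \<nu> \<kappa> S = - lambda_minus \<nu> S + mu_minus \<nu> \<kappa> S - 1 / (\<nu>\<^sup>2 * S * \<kappa>)"

definition tau_mp :: "real \<Rightarrow> real \<Rightarrow> real \<Rightarrow> real" where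
  "tau_mp \<nu> \<kappa> S = - lambda_minus \<nu> S + mu_plus \<nu> \<kappa> S - 1 / (\<nu>\<^sup>2 * S * \<kappa>)"

definition tau_pm :: "real \<Rightarrow> real \<Rightarrow> real \<Rightarrow> real" where
  "tau_pm \<nu> \<kappa> S = - lambda_plus \<nu> S + mu_minus \<nu> \<kappa> S - 1 / (\<nu>\<^sup>2 * S * \<kappa>)"

definition tau_pp :: "real \<Rightarrow> real \<Rightarrow> real \<Rightarrow> real" where
  "tau_pp \<nu> \<kappa> S = - lambda_plus \<nu> S + mu_plus \<nu> \<kappa> S - 1 / (\<nu>\<^sup>2 * S * \<kappa>)"

definition test_function :: "(real \<Rightarrow> real) \<Rightarrow> bool" where
  "test_function \<phi> \<longleftrightarrow>
     (\<forall>n x. (deriv ^^ n) \<phi> field_differentiable at x) \<and> compact (closure {x. \<phi> x \<noteq> 0})"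

definition tw_coeff :: "real \<Rightarrow> real \<Rightarrow> real \<Rightarrow> real" where
  "tw_coeff \<kappa> \<Xi> X = (if X \<in> {-\<Xi>..\<Xi>} then 1 / \<kappa> else 0)"

text \<open>The equation \<open>S V - \<nu>\<^sup>2 S V'' = (V - c V)'\<close> in the sense of distributions, i.e. with all
  derivatives moved to the test function. For continuous \<open>V\<close> both integrands are bounded,
  compactly supported and piecewise continuous, so the integrals exist.\<close>

definition weak_tw_equation ::
  "real \<Rightarrow> real \<Rightarrow> real \<Rightarrow> real \<Rightarrow> (real \<Rightarrow> real) \<Rightarrow> bool" where
  "weak_tw_equation \<nu> \<kappa> S \<Xi> V \<longleftrightarrow>
     (\<forall>\<phi>. test_function \<phi> \<longrightarrow>
        integral UNIV (\<lambda>X. S * V X * \<phi> X - \<nu>\<^sup>2 * S * V X * deriv (deriv \<phi>) X) =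
        - integral UNIV (\<lambda>X. (V X - tw_coeff \<kappa> \<Xi> X * V X) * deriv \<phi> X))"

definition tw_solution ::
  "real \<Rightarrow> real \<Rightarrow> real \<Rightarrow> real \<Rightarrow> (real \<Rightarrow> real) \<Rightarrow> bool" where
  "tw_solution \<nu> \<kappa> S \<Xi> V \<longleftrightarrow>
     continuous_on UNIV V \<and>
     weak_tw_equation \<nu> \<kappa> S \<Xi> V \<and>
     (\<forall>X. V X \<ge> 0) \<and>
     integral {-\<Xi>..\<Xi>} V = 2 * \<kappa>"

text \<open>\<open>tw_coefficients \<nu> \<kappa> S \<Xi> V Am Ap Bm Bp Cm Cp\<close>: the function \<open>V\<close> is piecewise exponential
  with coefficients \<open>A\<^sub>-, A\<^sub>+, B\<^sub>-, B\<^sub>+, C\<^sub>-, C\<^sub>+\<close>. The pieces overlap at \<open>\<plusminus>\<Xi>\<close>, so continuity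
  there is included.\<close>

definition tw_coefficients ::
  "real \<Rightarrow> real \<Rightarrow> real \<Rightarrow> real \<Rightarrow> (real \<Rightarrow> real) \<Rightarrow>
   real \<Rightarrow> real \<Rightarrow> real \<Rightarrow> real \<Rightarrow> real \<Rightarrow> real \<Rightarrow> bool" where
  "tw_coefficients \<nu> \<kappa> S \<Xi> V Am Ap Bm Bp Cm Cp \<longleftrightarrow>
     (\<forall>X\<in>{..-\<Xi>}. V X = Am * exp (lambda_minus \<nu> S * X) + Ap * exp (lambda_plus \<nu> S * X)) \<and>
     (\<forall>X\<in>{-\<Xi>..\<Xi>}. V X = Bm * exp (mu_minus \<nu> \<kappa> S * X) + Bp * exp (mu_plus \<nu> \<kappa> S * X)) \<and>
     (\<forall>X\<in>{\<Xi>..}. V X = Cm * exp (lambda_minus \<nu> S * X) + Cp * exp (lambda_plus \<nu> S * X))"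

definition tw_solution_ratio ::
  "real \<Rightarrow> real \<Rightarrow> real \<Rightarrow> real \<Rightarrow> real \<Rightarrow> (real \<Rightarrow> real) \<Rightarrow> bool" where
  "tw_solution_ratio \<nu> \<kappa> S \<Xi> \<sigma> V \<longleftrightarrow>
     tw_solution \<nu> \<kappa> S \<Xi> V \<and>
     (\<exists>Am Ap Bm Bp Cm Cp. tw_coefficients \<nu> \<kappa> S \<Xi> V Am Ap Bm Bp Cm Cp \<and> Bm = \<sigma> * Bp \<and> Bp > 0)"

definition sigma_range :: "real \<Rightarrow> real \<Rightarrow> real \<Rightarrow> real \<Rightarrow> real set" where
  "sigma_range \<nu> \<kappa> S \<Xi> =
     {- (tau_pp \<nu> \<kappa> S / tau_pm \<nu> \<kappa> S) * exp (- ((mu_plus \<nu> \<kappa> S - mu_minus \<nu> \<kappa> S) * \<Xi>)) ..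
      - (tau_mp \<nu> \<kappa> S / tau_mm \<nu> \<kappa> S) * exp ((mu_plus \<nu> \<kappa> S - mu_minus \<nu> \<kappa> S) * \<Xi>)}"

end

theory Submission
  imports Defs
begin

text \<open>
  The idea is to trade the weak second order equation for a first order system. Put
  \<open>Q = \<nu>\<^sup>2 S V' + (1 - c) V\<close>. A continuous \<open>V\<close> solves the weak equation exactly when some
  continuous \<open>Q\<close> satisfies \<open>Q' = S V\<close> and \<open>\<nu>\<^sup>2 S V' = Q - (1 - c) V\<close> off the two points \<open>\<plusminus>\<Xi>\<close>
  (\<open>weak_tw_equation_of_flux\<close>, \<open>flux_of_weak_tw_equation\<close>); continuity of \<open>Q\<close> replaces the jump conditions.
  One direction is integration by parts. The other one is the lemma of du Bois-Reymond for second derivatives: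
  a continuous function orthogonal to all \<open>\<phi>''\<close> is affine.

  On each of the three intervals the system has constant coefficients, and for both rates \<open>r\<close> the
  combination \<open>Q + \<nu>\<^sup>2 S r V\<close> is a multiple of \<open>exp (r X)\<close>. Hence the solutions are exactly the
  profiles obtained from arbitrary \<open>B\<^sub>-\<close> and \<open>B\<^sub>+\<close> on \<open>I\<^sub>0\<close> by propagating value and flux at \<open>\<plusminus>\<Xi>\<close>
  outwards (\<open>profile_flux\<close>, \<open>flux_is_profile\<close>).

  It remains to decide which profiles are nonnegative. At \<open>- \<infinity>\<close> the mode \<open>\<lambda>\<^sub>-\<close> dominates, at
  \<open>+ \<infinity>\<close> the mode \<open>\<lambda>\<^sub>+\<close>, so \<open>A\<^sub>- \<ge> 0\<close> and \<open>C\<^sub>+ \<ge> 0\<close> are necessary. Both are linear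
  inequalities in \<open>B\<^sub>-\<close> and \<open>B\<^sub>+\<close>, namely \<open>sigma_min B\<^sub>+ \<le> B\<^sub>- \<le> sigma_max B\<^sub>+\<close> with the two ends of the
  stated range (\<open>left_amplitude_sign\<close>, \<open>right_amplitude_sign\<close>). Since
  \<open>sigma_min < 0 < sigma_max\<close>, they force \<open>B\<^sub>+ > 0\<close> unless \<open>V\<close> vanishes on \<open>I\<^sub>0\<close>. Conversely, for
  \<open>B\<^sub>+ > 0\<close> the lower bound makes \<open>V\<close> positive on \<open>I\<^sub>0\<close>, and the two sign conditions extend
  positivity to the half-lines (\<open>profile_pos\<close>). The remaining factor \<open>B\<^sub>+\<close> is fixed by the
  integral constraint. All signs come from the interlacing
  \<open>\<lambda>\<^sub>- < \<mu>\<^sub>- < \<lambda>\<^sub>+ < \<mu>\<^sub>+\<close> of the rates.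
\<close>

section \<open>Smooth functions with compact support\<close>

text \<open>The factors \<open>(1 / x) ^ k\<close> make the linear span of the family closed under differentiation:
  smoothness of \<open>exp (- 1 / x)\<close> cut off at the origin becomes a statement about first derivatives only.\<close>
definition flat :: "nat \<Rightarrow> real \<Rightarrow> real" where
  "flat k x = (if x > 0 then (1 / x) ^ k * exp (- (1 / x)) else 0)"

lemma flat_tendsto_0: "(flat k \<longlongrightarrow> 0) (at 0)"
proof -
  have "((\<lambda>x::real. (inverse x) ^ k / exp (inverse x)) \<longlongrightarrow> 0) (at_right 0)"
    by (rule filterlim_compose[OF tendsto_power_div_exp_0 filterlim_inverse_at_top_right])
  moreover have "eventually (\<lambda>x. (inverse x) ^ k / exp (inverse x) = flat k x) (at_right (0::real))"
    unfolding eventually_at_right_field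
    by (auto intro!: exI[of _ 1] simp: flat_def exp_minus field_simps)
  ultimately have "(flat k \<longlongrightarrow> 0) (at_right 0)"
    using Lim_transform_eventually by blast
  moreover have "(flat k \<longlongrightarrow> 0) (at_left 0)"
    by (rule tendsto_eventually) (auto simp: flat_def eventually_at_left_field intro!: exI[of _ "-1"])
  ultimately show ?thesis
    by (simp add: filterlim_split_at_real)
qed

lemma flat_has_derivative:
  "(flat k has_real_derivative flat (k + 2) x - real k * flat (k + 1) x) (at x)"
proof -
  consider "x < 0" | "x = 0" | "x > 0" by linarith
  then show ?thesis
  proof cases
    case 1
    have "(flat k has_real_derivative 0) (at x)"
      by (rule has_field_derivative_transform_within_open[where S="{..<0}" and f="\<lambda>_. 0"])
         (use 1 in \<open>auto simp: flat_def\<close>)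
    with 1 show ?thesis by (simp add: flat_def)
  next
    case 2
    \<comment> \<open>the difference quotient at the origin is again a flat function\<close>
    have "(\<lambda>h. (flat k (0 + h) - flat k 0) / h) = flat (k + 1)"
      by (auto simp: flat_def fun_eq_iff)
    then have "(flat k has_real_derivative 0) (at 0)"
      using flat_tendsto_0[of "k + 1"] by (simp add: DERIV_def)
    with 2 show ?thesis by (simp add: flat_def)
  next
    case 3
    have pw: "real k * inverse x ^ (k - Suc 0) * inverse x * inverse x = real k * inverse x ^ (k + 1)"
      by (cases k) (auto simp: field_simps)
    have "((\<lambda>x. (inverse x) ^ k * exp (- inverse x)) has_real_derivative
        flat (k + 2) x - real k * flat (k + 1) x) (at x)"
      using 3 pw
      by (auto intro!: derivative_eq_intros simp: flat_def power_add power2_eq_square algebra_simps divide_inverse)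
    then show ?thesis
      by (rule has_field_derivative_transform_within_open[where S="{0<..}"])
         (use 3 in \<open>auto simp: flat_def divide_inverse\<close>)
  qed
qed

text \<open>An algebra of functions generated from the flat functions by operations whose results have
  derivatives that are again built from members by these operations. Iterated derivatives then never have to be
  computed: every member has a derivative in the algebra, hence derivatives of all orders.\<close>
inductive_set smooth_alg :: "(real \<Rightarrow> real) set" where
  flat: "flat k \<in> smooth_alg"
| const: "(\<lambda>_. c) \<in> smooth_alg"
| affine: "f \<in> smooth_alg \<Longrightarrow> (\<lambda>x. f (a + b * x)) \<in> smooth_alg"
| add: "f \<in> smooth_alg \<Longrightarrow> g \<in> smooth_alg \<Longrightarrow> (\<lambda>x. f x + g x) \<in> smooth_alg"
| mult: "f \<in> smooth_alg \<Longrightarrow> g \<in> smooth_alg \<Longrightarrow> (\<lambda>x. f x * g x) \<in> smooth_alg"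
| primitive: "f \<in> smooth_alg \<Longrightarrow> (\<And>x. (F has_real_derivative f x) (at x)) \<Longrightarrow> F \<in> smooth_alg"

lemma smooth_alg_derivative:
  "f \<in> smooth_alg \<Longrightarrow> \<exists>f'\<in>smooth_alg. \<forall>x. (f has_real_derivative f' x) (at x)"
proof (induction rule: smooth_alg.induct)
  case (flat k)
  have "(\<lambda>x. flat (k + 2) x + (- real k) * flat (k + 1) x) \<in> smooth_alg"
    by (intro smooth_alg.add smooth_alg.mult smooth_alg.const smooth_alg.flat)
  moreover have "\<forall>x. (flat k has_real_derivative flat (k + 2) x + (- real k) * flat (k + 1) x) (at x)"
    using flat_has_derivative[of k] by simp
  ultimately show ?case
    by (intro bexI[of _ "\<lambda>x. flat (k + 2) x + (- real k) * flat (k + 1) x"])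
next
  case (const c)
  show ?case by (rule bexI[OF _ smooth_alg.const[of 0]]) auto
next
  case (affine f a b)
  then obtain f' where f': "f' \<in> smooth_alg" "\<And>x. (f has_real_derivative f' x) (at x)" by auto
  have "((\<lambda>x. f (a + b * x)) has_real_derivative b * f' (a + b * x)) (at x)" for x
  proof -
    have "((\<lambda>x. a + b * x) has_real_derivative b) (at x)"
      by (auto intro!: derivative_eq_intros)
    from DERIV_chain2[OF f'(2) this] show ?thesis by (simp add: mult.commute)
  qed
  moreover have "(\<lambda>x. b * f' (a + b * x)) \<in> smooth_alg"
    by (rule smooth_alg.mult[OF smooth_alg.const smooth_alg.affine[OF f'(1)]])
  ultimately show ?case by (intro bexI[of _ "\<lambda>x. b * f' (a + b * x)"]) auto
next
  case (add f g)
  then obtain f' g' where f': "f' \<in> smooth_alg" "\<And>x. (f has_real_derivative f' x) (at x)"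
    and g': "g' \<in> smooth_alg" "\<And>x. (g has_real_derivative g' x) (at x)" by auto
  show ?case
    by (rule bexI[OF _ smooth_alg.add[OF f'(1) g'(1)]]) (intro allI DERIV_add f'(2) g'(2))
next
  case (mult f g)
  then obtain f' g' where f': "f' \<in> smooth_alg" "\<And>x. (f has_real_derivative f' x) (at x)"
    and g': "g' \<in> smooth_alg" "\<And>x. (g has_real_derivative g' x) (at x)" by auto
  show ?case
    by (rule bexI[OF _ smooth_alg.add[OF smooth_alg.mult[OF mult.hyps(1) g'(1)] smooth_alg.mult[OF f'(1) mult.hyps(2)]]])
       (intro allI DERIV_mult' f'(2) g'(2))
next
  case (primitive f F)
  then show ?case by blast
qed

lemma smooth_alg_smooth:
  assumes "f \<in> smooth_alg"
  shows "(deriv ^^ n) f field_differentiable at x"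
proof -
  have "(deriv ^^ n) f \<in> smooth_alg"
  proof (induction n)
    case (Suc n)
    then obtain f' where "f' \<in> smooth_alg" "\<forall>x. ((deriv ^^ n) f has_real_derivative f' x) (at x)"
      using smooth_alg_derivative by blast
    moreover from this have "deriv ((deriv ^^ n) f) = f'"
      by (auto intro!: DERIV_imp_deriv)
    ultimately show ?case by simp
  qed (simp add: assms)
  then show ?thesis
    using smooth_alg_derivative unfolding field_differentiable_def by blast
qed

lemma smooth_alg_continuous: "f \<in> smooth_alg \<Longrightarrow> continuous_on A f"
  by (meson smooth_alg_derivative DERIV_continuous continuous_at_imp_continuous_on)

text \<open>A primitive on the whole line, with no base point, so that it may be chosen for every
  continuous function without sign conventions for integrals.\<close>
lemma continuous_has_primitive:
  fixes f :: "real \<Rightarrow> real"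
  assumes "continuous_on UNIV f"
  obtains F where "\<And>x. (F has_real_derivative f x) (at x)"
proof -
  have "\<exists>F. \<forall>x. (-\<infinity>::ereal) < ereal x \<longrightarrow> ereal x < \<infinity> \<longrightarrow> (F has_vector_derivative f x) (at x)"
    by (rule einterval_antiderivative) (use assms in \<open>auto simp: continuous_on_eq_continuous_at\<close>)
  then show thesis using that by (auto simp: has_real_derivative_iff_has_vector_derivative)
qed

lemma smooth_alg_bump:
  assumes "\<epsilon> > 0"
  obtains \<eta> where "\<eta> \<in> smooth_alg" "\<And>x. \<eta> x \<ge> 0" "\<And>x. \<bar>x\<bar> < \<epsilon> \<Longrightarrow> \<eta> x > 0" "\<And>x. \<bar>x\<bar> \<ge> \<epsilon> \<Longrightarrow> \<eta> x = 0"
proof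
  let ?\<eta> = "\<lambda>x. flat 0 (\<epsilon> + 1 * x) * flat 0 (\<epsilon> + (-1) * x)"
  show "?\<eta> \<in> smooth_alg" by (rule smooth_alg.mult[OF smooth_alg.affine[OF smooth_alg.flat] smooth_alg.affine[OF smooth_alg.flat]])
qed (auto simp: flat_def)

section \<open>The lemma of du Bois-Reymond for second derivatives\<close>

lemma affine_of_second_derivative_zero:
  fixes E :: "real \<Rightarrow> real"
  assumes "convex A" "open A"
    and E: "\<And>x. x \<in> A \<Longrightarrow> (E has_real_derivative E' x) (at x)"
    and E': "\<And>x. x \<in> A \<Longrightarrow> (E' has_real_derivative 0) (at x)"
  obtains p q where "\<And>x. x \<in> A \<Longrightarrow> E x = p + q * x"
proof -
  have "(E' has_real_derivative 0) (at x within A)" if "x \<in> A" for x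
    by (rule has_field_derivative_at_within[OF E'[OF that]])
  then have "\<exists>q. \<forall>x\<in>A. E' x = q"
    by (intro has_field_derivative_zero_constant[OF \<open>convex A\<close>]) auto
  then obtain q where q: "\<And>x. x \<in> A \<Longrightarrow> E' x = q" by auto
  have "((\<lambda>x. E x - q * x) has_real_derivative 0) (at x within A)" if "x \<in> A" for x
  proof -
    have "((\<lambda>x. E x - q * x) has_real_derivative E' x - q * 1) (at x within A)"
      by (intro DERIV_diff DERIV_cmult DERIV_ident has_field_derivative_at_within[OF E[OF that]])
    then show ?thesis using q[OF that] by simp
  qed
  then have "\<exists>p. \<forall>x\<in>A. E x - q * x = p"
    by (intro has_field_derivative_zero_constant[OF \<open>convex A\<close>]) auto
  then obtain p where "\<And>x. x \<in> A \<Longrightarrow> E x - q * x = p" by auto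
  then show thesis by (intro that[of p q]) (simp add: algebra_simps)
qed

lemma continuous_nonzero_near:
  fixes D :: "real \<Rightarrow> real"
  assumes "continuous_on UNIV D" "D 0 > 0"
  obtains \<epsilon> where "\<epsilon> > 0" "\<And>t. \<bar>t\<bar> < \<epsilon> \<Longrightarrow> D t > 0"
proof -
  have "open (D -` {0<..})" using assms(1) by (simp add: open_vimage)
  then obtain \<epsilon> where "\<epsilon> > 0" and \<epsilon>: "\<And>t. dist t 0 < \<epsilon> \<Longrightarrow> t \<in> D -` {0<..}"
    using assms(2) unfolding open_dist by fastforce
  have "D t > 0" if "\<bar>t\<bar> < \<epsilon>" for t
    using \<epsilon>[of t] that by simp
  with \<open>\<epsilon> > 0\<close> show thesis by (rule that)
qed

lemma integral_shifted_bump: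
  fixes f \<eta> :: "real \<Rightarrow> real"
  assumes f: "continuous_on UNIV f" and \<eta>: "continuous_on UNIV \<eta>" and supp: "\<And>x. \<bar>x\<bar> \<ge> \<epsilon> \<Longrightarrow> \<eta> x = 0"
  shows "((\<lambda>y. f y * \<eta> (y - s)) has_integral integral {-\<epsilon>..\<epsilon>} (\<lambda>t. f (t + s) * \<eta> t)) UNIV"
proof -
  have "((\<lambda>t. f (t + s) * \<eta> t) has_integral integral {-\<epsilon>..\<epsilon>} (\<lambda>t. f (t + s) * \<eta> t)) {-\<epsilon>..\<epsilon>}"
    by (intro integrable_integral integrable_continuous_real continuous_intros
        continuous_on_compose2[OF f] continuous_on_subset[OF \<eta>]) auto
  from has_integral_shift_real_ivl[OF this, of "-s"]
  have "((\<lambda>y. f y * \<eta> (y - s)) has_integral integral {-\<epsilon>..\<epsilon>} (\<lambda>t. f (t + s) * \<eta> t)) {-\<epsilon>+s..\<epsilon>+s}"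
    by simp
  then show ?thesis
    by (rule has_integral_on_superset) (auto intro!: supp)
qed

text \<open>If \<open>f b\<close> lay below the chord through the points \<open>0\<close> and \<open>1\<close>, a test function would detect it.
  Take a bump \<open>\<eta>\<close> and \<open>E\<close> with \<open>E'' = \<eta>\<close>. Away from the support of \<open>\<eta>\<close> the function \<open>E\<close> is affine,
  and the combination \<open>(1 - b) E(y) + b E(y - 1) - E(y - b)\<close> annihilates affine functions; it is
  therefore a test function, although \<open>E\<close> itself is not. Its second derivative is the same
  combination of shifted bumps, so \<open>f\<close> integrated against it averages the gap between chord
  and graph over a small neighbourhood, which cannot vanish.\<close>
lemma not_below_chord:
  fixes f :: "real \<Rightarrow> real"
  assumes f: "continuous_on UNIV f"
    and weak: "\<And>\<phi>. test_function \<phi> \<Longrightarrow> integral UNIV (\<lambda>x. f x * deriv (deriv \<phi>) x) = 0"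
  shows "\<not> f b < (1 - b) * f 0 + b * f 1"
proof
  assume less: "f b < (1 - b) * f 0 + b * f 1"
  \<comment> \<open>\<open>D 0\<close> is the height of the chord over the graph at \<open>b\<close>\<close>
  define D where "D t = (1 - b) * f (t + 0) + b * f (t + 1) - f (t + b)" for t
  have D: "continuous_on UNIV D" unfolding D_def
    by (intro continuous_intros continuous_on_compose2[OF f]) auto
  obtain \<epsilon> where \<epsilon>: "\<epsilon> > 0" "\<And>t. \<bar>t\<bar> < \<epsilon> \<Longrightarrow> D t > 0"
    using continuous_nonzero_near[OF D] less by (auto simp: D_def)
  obtain \<eta> where \<eta>: "\<eta> \<in> smooth_alg" "\<And>x. \<eta> x \<ge> 0" "\<And>x. \<bar>x\<bar> < \<epsilon> \<Longrightarrow> \<eta> x > 0" "\<And>x. \<bar>x\<bar> \<ge> \<epsilon> \<Longrightarrow> \<eta> x = 0"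
    using smooth_alg_bump[OF \<epsilon>(1)] by blast
  note \<eta>c = smooth_alg_continuous[OF \<eta>(1)]
  obtain E' where E': "\<And>x. (E' has_real_derivative \<eta> x) (at x)"
    using continuous_has_primitive[OF \<eta>c] by blast
  obtain E where E: "\<And>x. (E has_real_derivative E' x) (at x)"
    using continuous_has_primitive[OF smooth_alg_continuous[OF smooth_alg.primitive[OF \<eta>(1) E']]] by blast
  have Es: "E \<in> smooth_alg"
    by (rule smooth_alg.primitive[OF smooth_alg.primitive[OF \<eta>(1) E'] E])
  define \<phi> where "\<phi> y = (1 - b) * E (y - 0) + b * E (y - 1) - E (y - b)" for y
  have shift: "((\<lambda>y. F (y - s)) has_real_derivative F' (y - s)) (at y)"
    if "\<And>x. (F has_real_derivative F' x) (at x)" for F F' :: "real \<Rightarrow> real" and s y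
  proof -
    have "((\<lambda>y. y - s) has_real_derivative 1) (at y)" by (auto intro!: derivative_eq_intros)
    from DERIV_chain2[OF that this] show ?thesis by simp
  qed
  have \<phi>1: "deriv \<phi> = (\<lambda>y. (1 - b) * E' (y - 0) + b * E' (y - 1) - E' (y - b))"
    unfolding \<phi>_def by (intro ext DERIV_imp_deriv DERIV_diff DERIV_add DERIV_cmult shift[OF E])
  have \<phi>2: "deriv (deriv \<phi>) = (\<lambda>y. (1 - b) * \<eta> (y - 0) + b * \<eta> (y - 1) - \<eta> (y - b))"
    unfolding \<phi>1 by (intro ext DERIV_imp_deriv DERIV_diff DERIV_add DERIV_cmult shift[OF E'])
  have "\<phi> \<in> smooth_alg"
  proof -
    have "(\<lambda>y. (1 - b) * E (0 + 1 * y) + b * E (-1 + 1 * y) + (-1) * E (-b + 1 * y)) \<in> smooth_alg"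
      by (rule smooth_alg.add smooth_alg.mult smooth_alg.const smooth_alg.affine[OF Es])+
    also have "(\<lambda>y. (1 - b) * E (0 + 1 * y) + b * E (-1 + 1 * y) + (-1) * E (-b + 1 * y)) = \<phi>"
      by (auto simp: \<phi>_def fun_eq_iff)
    finally show ?thesis .
  qed
  moreover have "compact (closure {x. \<phi> x \<noteq> 0})"
  proof -
    have E'0: "(E' has_real_derivative 0) (at x)" if "\<bar>x\<bar> \<ge> \<epsilon>" for x
      using E'[of x] \<eta>(4)[OF that] by simp
    obtain p q where r: "\<And>x. x \<in> {\<epsilon><..} \<Longrightarrow> E x = p + q * x"
      by (rule affine_of_second_derivative_zero[of "{\<epsilon><..}", OF _ _ E E'0]) auto
    obtain p' q' where l: "\<And>x. x \<in> {..<-\<epsilon>} \<Longrightarrow> E x = p' + q' * x"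
      by (rule affine_of_second_derivative_zero[of "{..<-\<epsilon>}", OF _ _ E E'0]) auto
    \<comment> \<open>beyond this radius all three arguments lie on the same side of the support of \<open>\<eta>\<close>\<close>
    have "\<phi> x = 0" if "\<bar>x\<bar> > \<epsilon> + 1 + \<bar>b\<bar>" for x
    proof (cases "x > 0")
      case True
      then have "E (x - 0) = p + q * (x - 0)" "E (x - 1) = p + q * (x - 1)" "E (x - b) = p + q * (x - b)"
        using that by (auto intro!: r)
      then show ?thesis unfolding \<phi>_def by (simp only:) (simp add: algebra_simps)
    next
      case False
      then have "E (x - 0) = p' + q' * (x - 0)" "E (x - 1) = p' + q' * (x - 1)" "E (x - b) = p' + q' * (x - b)"
        using that by (auto intro!: l)
      then show ?thesis unfolding \<phi>_def by (simp only:) (simp add: algebra_simps)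
    qed
    then have "{x. \<phi> x \<noteq> 0} \<subseteq> cball 0 (\<epsilon> + 1 + \<bar>b\<bar>)"
      by (force simp: not_less[symmetric])
    then show ?thesis using bounded_subset compact_closure bounded_cball by blast
  qed
  ultimately have "test_function \<phi>"
    unfolding test_function_def using smooth_alg_smooth by blast
  from weak[OF this]
  have 0: "integral UNIV (\<lambda>y. f y * ((1 - b) * \<eta> (y - 0) + b * \<eta> (y - 1) - \<eta> (y - b))) = 0"
    by (simp only: \<phi>2)
  \<comment> \<open>moving the shifts from the bumps to \<open>f\<close> turns the vanishing integral into one of \<open>D * \<eta>\<close>\<close>
  let ?J = "\<lambda>s. integral {-\<epsilon>..\<epsilon>} (\<lambda>t. f (t + s) * \<eta> t)"
  note bump_shift = integral_shifted_bump[OF f \<eta>c \<eta>(4)]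
  have "((\<lambda>y. (1 - b) * (f y * \<eta> (y - 0)) + b * (f y * \<eta> (y - 1)) - f y * \<eta> (y - b)) has_integral
      (1 - b) * ?J 0 + b * ?J 1 - ?J b) UNIV"
    by (intro has_integral_add has_integral_diff has_integral_mult_right bump_shift)
  then have "(1 - b) * ?J 0 + b * ?J 1 - ?J b = 0"
    using 0 by (simp add: algebra_simps integral_unique)
  moreover have "((\<lambda>t. D t * \<eta> t) has_integral (1 - b) * ?J 0 + b * ?J 1 - ?J b) {-\<epsilon>..\<epsilon>}"
  proof -
    have "((\<lambda>t. f (t + s) * \<eta> t) has_integral ?J s) {-\<epsilon>..\<epsilon>}" for s
      by (intro integrable_integral integrable_continuous_real continuous_intros
        continuous_on_compose2[OF f] continuous_on_subset[OF \<eta>c]) auto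
    then have "((\<lambda>t. (1 - b) * (f (t + 0) * \<eta> t) + b * (f (t + 1) * \<eta> t) - f (t + b) * \<eta> t)
       has_integral (1 - b) * ?J 0 + b * ?J 1 - ?J b) {-\<epsilon>..\<epsilon>}"
      by (intro has_integral_add has_integral_diff has_integral_mult_right)
    then show ?thesis by (rule has_integral_eq[rotated]) (simp add: D_def algebra_simps)
  qed
  ultimately have "integral {-\<epsilon>..\<epsilon>} (\<lambda>t. D t * \<eta> t) = 0" by (simp add: integral_unique)
  moreover have "D t * \<eta> t \<ge> 0" if "t \<in> {-\<epsilon>..\<epsilon>}" for t
    using \<epsilon>(2)[of t] \<eta>(2)[of t] \<eta>(4)[of t] by (cases "\<bar>t\<bar> < \<epsilon>") auto
  moreover have "continuous_on {-\<epsilon>..\<epsilon>} (\<lambda>t. D t * \<eta> t)"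
    by (intro continuous_on_mult continuous_on_subset[OF D] \<eta>c) auto
  ultimately have "\<forall>t\<in>{-\<epsilon>..\<epsilon>}. D t * \<eta> t = 0"
    using integral_eq_0_iff[of "-\<epsilon>" \<epsilon> "\<lambda>t. D t * \<eta> t"] \<epsilon>(1) by auto
  then have "D 0 * \<eta> 0 = 0" using \<epsilon>(1) by simp
  then show False using \<epsilon>(1) \<epsilon>(2)[of 0] \<eta>(3)[of 0] by simp
qed

text \<open>The obstruction applies to \<open>f\<close> and to \<open>- f\<close>, so every point of the graph lies on the chord
  through \<open>0\<close> and \<open>1\<close>.\<close>
lemma du_Bois_Reymond_second_order:
  fixes f :: "real \<Rightarrow> real"
  assumes f: "continuous_on UNIV f"
    and weak: "\<And>\<phi>. test_function \<phi> \<Longrightarrow> integral UNIV (\<lambda>x. f x * deriv (deriv \<phi>) x) = 0"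
  obtains \<alpha> \<beta> where "\<And>x. f x = \<alpha> + \<beta> * x"
proof -
  have "f b = (1 - b) * f 0 + b * f 1" for b
  proof -
    have "\<not> - f b < (1 - b) * - f 0 + b * - f 1"
      using not_below_chord[of "\<lambda>x. - f x" b] f weak by (simp add: continuous_on_minus)
    with not_below_chord[OF f weak, of b] show ?thesis by (simp add: algebra_simps)
  qed
  then have "f x = f 0 + (f 1 - f 0) * x" for x by (simp add: algebra_simps)
  then show thesis by (rule that)
qed

section \<open>The weak equation as a first order system\<close>

text \<open>\<open>Q\<close> is \<open>\<nu>\<^sup>2 S V' + (1 - c) V\<close>, the quantity that the equation requires to have the derivative
  \<open>S V\<close>. The continuity of \<open>Q\<close> at \<open>\<plusminus>\<Xi>\<close> is the pair of jump conditions for \<open>V'\<close>, and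
  nothing has to be said about derivatives at these two points.\<close>
definition tw_flux :: "real \<Rightarrow> real \<Rightarrow> real \<Rightarrow> real \<Rightarrow> (real \<Rightarrow> real) \<Rightarrow> (real \<Rightarrow> real) \<Rightarrow> bool" where
  "tw_flux \<nu> \<kappa> S \<Xi> V Q \<longleftrightarrow>
     continuous_on UNIV Q \<and>
     (\<forall>X. X \<noteq> -\<Xi> \<and> X \<noteq> \<Xi> \<longrightarrow>
        (Q has_real_derivative S * V X) (at X) \<and>
        (V has_real_derivative (Q X - (1 - tw_coeff \<kappa> \<Xi> X) * V X) / (\<nu>\<^sup>2 * S)) (at X))"

lemma test_function_support:
  assumes "test_function \<phi>"
  obtains R where "R > 0"
    "\<And>x. \<bar>x\<bar> > R \<Longrightarrow> \<phi> x = 0 \<and> deriv \<phi> x = 0 \<and> deriv (deriv \<phi>) x = 0"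
proof -
  have "bounded {x. \<phi> x \<noteq> 0}"
    using assms unfolding test_function_def
    by (meson bounded_subset closure_subset compact_imp_bounded)
  then obtain R where R: "R > 0" "\<And>x. \<phi> x \<noteq> 0 \<Longrightarrow> \<bar>x\<bar> \<le> R"
    by (auto simp: bounded_pos)
  have deriv0: "deriv g x = 0" if "\<bar>x\<bar> > R" "\<And>y. \<bar>y\<bar> > R \<Longrightarrow> g y = 0" for g :: "real \<Rightarrow> real" and x
  proof (rule DERIV_imp_deriv)
    have "open {y::real. \<bar>y\<bar> > R}" by (intro open_Collect_less continuous_intros)
    then show "(g has_real_derivative 0) (at x)"
      by (rule has_field_derivative_transform_within_open[where f="\<lambda>_. 0", rotated 1]) (use that in auto)
  qed
  have 0: "\<phi> x = 0" if "\<bar>x\<bar> > R" for x using R(2)[of x] that by force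
  have 1: "deriv \<phi> x = 0" if "\<bar>x\<bar> > R" for x by (rule deriv0[OF that 0])
  have 2: "deriv (deriv \<phi>) x = 0" if "\<bar>x\<bar> > R" for x by (rule deriv0[OF that 1])
  show thesis using that[OF R(1)] 0 1 2 by blast
qed

lemma test_function_derivatives:
  assumes "test_function \<phi>"
  shows "(\<phi> has_real_derivative deriv \<phi> x) (at x)"
    and "(deriv \<phi> has_real_derivative deriv (deriv \<phi>) x) (at x)"
    and "continuous_on A \<phi>" "continuous_on A (deriv \<phi>)" "continuous_on A (deriv (deriv \<phi>))"
proof -
  have *: "(deriv ^^ n) \<phi> field_differentiable at x" for n x
    using assms unfolding test_function_def by blast
  have 0: "\<phi> field_differentiable at x" for x using *[of 0] by simp
  have 1: "deriv \<phi> field_differentiable at x" for x using *[of 1] by simp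
  have 2: "deriv (deriv \<phi>) field_differentiable at x" for x using *[of 2] by (simp add: numeral_2_eq_2)
  show "(\<phi> has_real_derivative deriv \<phi> x) (at x)"
    "(deriv \<phi> has_real_derivative deriv (deriv \<phi>) x) (at x)"
    using 0 1 by (simp_all add: DERIV_deriv_iff_field_differentiable)
  show "continuous_on A \<phi>" "continuous_on A (deriv \<phi>)" "continuous_on A (deriv (deriv \<phi>))"
    using 0 1 2
    by (auto intro!: continuous_at_imp_continuous_on field_differentiable_imp_continuous_at)
qed

lemma has_integral_derivative_compact_support:
  fixes F g :: "real \<Rightarrow> real"
  assumes "finite K" and F: "continuous_on UNIV F"
    and deriv: "\<And>x. x \<notin> K \<Longrightarrow> (F has_real_derivative g x) (at x)"
    and "R > 0" and supp: "\<And>x. \<bar>x\<bar> > R \<Longrightarrow> F x = 0 \<and> g x = 0"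
  shows "(g has_integral 0) UNIV"
proof -
  have "(g has_integral F (R + 1) - F (- (R + 1))) {- (R + 1)..R + 1}"
    by (rule fundamental_theorem_of_calculus_interior_strong[OF \<open>finite K\<close>])
       (use \<open>R > 0\<close> deriv in \<open>auto intro: continuous_on_subset[OF F] simp flip: has_real_derivative_iff_has_vector_derivative\<close>)
  then have "(g has_integral 0) {- (R + 1)..R + 1}"
    using supp[of "R + 1"] supp[of "- (R + 1)"] \<open>R > 0\<close> by simp
  then show ?thesis
    by (rule has_integral_on_superset) (use supp in auto)
qed

lemma integrable_compact_support:
  fixes g :: "real \<Rightarrow> real"
  assumes g: "continuous_on UNIV g" and supp: "\<And>x. \<bar>x\<bar> > R \<Longrightarrow> g x = 0"
  shows "g integrable_on UNIV"
proof (rule integrable_on_superset)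
  show "g integrable_on {- R..R}"
    by (intro integrable_continuous_real continuous_on_subset[OF g]) auto
qed (use supp in auto)

text \<open>The integrand of the weak equation is the derivative, off \<open>\<plusminus>\<Xi>\<close>, of the continuous and compactly
  supported function \<open>Q \<phi> - \<nu>\<^sup>2 S V \<phi>'\<close>. No boundary terms arise at \<open>\<plusminus>\<Xi>\<close> because
  \<open>Q\<close> and \<open>V\<close> are continuous there.\<close>
lemma weak_tw_equation_of_flux:
  assumes V: "continuous_on UNIV V" and flux: "tw_flux \<nu> \<kappa> S \<Xi> V Q" and "\<nu> \<noteq> 0" "S \<noteq> 0"
  shows "weak_tw_equation \<nu> \<kappa> S \<Xi> V"
  unfolding weak_tw_equation_def
proof (intro allI impI)
  fix \<phi> assume \<phi>: "test_function \<phi>"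
  obtain R where R: "R > 0" "\<And>x. \<bar>x\<bar> > R \<Longrightarrow> \<phi> x = 0 \<and> deriv \<phi> x = 0 \<and> deriv (deriv \<phi>) x = 0"
    using test_function_support[OF \<phi>] by blast
  note d = test_function_derivatives[OF \<phi>]
  have Q: "continuous_on UNIV Q" using flux by (simp add: tw_flux_def)
  let ?a = "\<lambda>X. S * V X * \<phi> X - \<nu>\<^sup>2 * S * V X * deriv (deriv \<phi>) X"
  let ?b = "\<lambda>X. (V X - tw_coeff \<kappa> \<Xi> X * V X) * deriv \<phi> X"
  have "((\<lambda>X. ?a X + ?b X) has_integral 0) UNIV"
  proof (rule has_integral_derivative_compact_support[of "{-\<Xi>, \<Xi>}" "\<lambda>X. Q X * \<phi> X - \<nu>\<^sup>2 * S * (V X * deriv \<phi> X)" _ R])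
    show "continuous_on UNIV (\<lambda>X. Q X * \<phi> X - \<nu>\<^sup>2 * S * (V X * deriv \<phi> X))"
      by (intro continuous_intros V Q d)
    fix X assume "X \<notin> {-\<Xi>, \<Xi>}"
    then have Q': "(Q has_real_derivative S * V X) (at X)"
      and V': "(V has_real_derivative (Q X - (1 - tw_coeff \<kappa> \<Xi> X) * V X) / (\<nu>\<^sup>2 * S)) (at X)"
      using flux by (auto simp: tw_flux_def)
    have "((\<lambda>X. Q X * \<phi> X - \<nu>\<^sup>2 * S * (V X * deriv \<phi> X)) has_real_derivative
       (Q X * deriv \<phi> X + S * V X * \<phi> X) -
       \<nu>\<^sup>2 * S * (V X * deriv (deriv \<phi>) X + (Q X - (1 - tw_coeff \<kappa> \<Xi> X) * V X) / (\<nu>\<^sup>2 * S) * deriv \<phi> X)) (at X)"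
      by (intro DERIV_diff DERIV_cmult DERIV_mult' Q' V' d)
    also have "(Q X * deriv \<phi> X + S * V X * \<phi> X) -
       \<nu>\<^sup>2 * S * (V X * deriv (deriv \<phi>) X + (Q X - (1 - tw_coeff \<kappa> \<Xi> X) * V X) / (\<nu>\<^sup>2 * S) * deriv \<phi> X) = ?a X + ?b X"
      using assms(3,4) by (simp add: field_simps)
    finally show "((\<lambda>X. Q X * \<phi> X - \<nu>\<^sup>2 * S * (V X * deriv \<phi> X)) has_real_derivative ?a X + ?b X) (at X)" .
  qed (use R in auto)
  moreover have "?a integrable_on UNIV"
    by (rule integrable_compact_support[of _ R]) (use R in \<open>auto intro!: continuous_intros V d\<close>)
  ultimately have "((\<lambda>X. (?a X + ?b X) - ?a X) has_integral 0 - integral UNIV ?a) UNIV"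
    by (intro has_integral_diff integrable_integral)
  then have "(?b has_integral - integral UNIV ?a) UNIV" by simp
  then show "integral UNIV ?a = - integral UNIV ?b" by (simp add: integral_unique)
qed

lemma primitive_of_jump:
  fixes V :: "real \<Rightarrow> real"
  assumes V: "continuous_on UNIV V" and "\<Xi> > 0"
  obtains W where "continuous_on UNIV W"
    "\<And>X. X \<noteq> -\<Xi> \<Longrightarrow> X \<noteq> \<Xi> \<Longrightarrow> (W has_real_derivative (1 - tw_coeff \<kappa> \<Xi> X) * V X) (at X)"
proof -
  obtain G where G: "\<And>X. (G has_real_derivative V X) (at X)"
    using continuous_has_primitive[OF V] by blast
  have Gc: "continuous_on A G" for A
    by (rule continuous_at_imp_continuous_on) (use G DERIV_continuous in blast)
  \<comment> \<open>clipping the argument freezes the correction term outside \<open>I\<^sub>0\<close> and keeps \<open>W\<close> continuous\<close>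
  define W where "W X = G X - G (max (-\<Xi>) (min X \<Xi>)) / \<kappa>" for X
  have "continuous_on UNIV W"
  proof -
    have "continuous_on UNIV (\<lambda>X. G (max (-\<Xi>) (min X \<Xi>)))"
      by (rule continuous_on_compose2[OF Gc[of UNIV]]) (auto intro!: continuous_intros)
    moreover have "W = (\<lambda>X. G X - inverse \<kappa> * G (max (-\<Xi>) (min X \<Xi>)))"
      by (auto simp: W_def divide_inverse)
    ultimately show ?thesis by (auto intro!: continuous_intros Gc)
  qed
  moreover have "(W has_real_derivative (1 - tw_coeff \<kappa> \<Xi> X) * V X) (at X)" if X: "X \<noteq> -\<Xi>" "X \<noteq> \<Xi>" for X
  proof -
    have out: "((\<lambda>X. G X - c) has_real_derivative V X) (at X)" for c
      using DERIV_diff[OF G[of X] DERIV_const[of c]] by simp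
    have ins: "((\<lambda>X. G X - G X / \<kappa>) has_real_derivative V X - V X / \<kappa>) (at X)"
      by (intro DERIV_diff DERIV_cdivide G)
    consider "X < -\<Xi>" | "-\<Xi> < X" "X < \<Xi>" | "X > \<Xi>" using X by linarith
    then show ?thesis
    proof cases
      case 1
      have "(W has_real_derivative V X) (at X)"
        by (rule has_field_derivative_transform_within_open[OF out[of "G (-\<Xi>) / \<kappa>"], of "{..<-\<Xi>}"])
           (use 1 \<open>\<Xi> > 0\<close> in \<open>auto simp: W_def\<close>)
      then show ?thesis using 1 by (simp add: tw_coeff_def)
    next
      case 2
      have "(W has_real_derivative V X - V X / \<kappa>) (at X)"
        by (rule has_field_derivative_transform_within_open[OF ins, of "{-\<Xi><..<\<Xi>}"])
           (use 2 in \<open>auto simp: W_def\<close>)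
      then show ?thesis using 2 by (simp add: tw_coeff_def algebra_simps)
    next
      case 3
      have "(W has_real_derivative V X) (at X)"
        by (rule has_field_derivative_transform_within_open[OF out[of "G \<Xi> / \<kappa>"], of "{\<Xi><..}"])
           (use 3 \<open>\<Xi> > 0\<close> in \<open>auto simp: W_def\<close>)
      then show ?thesis using 3 by (simp add: tw_coeff_def)
    qed
  qed
  ultimately show thesis by (rule that)
qed

text \<open>Every term of the weak equation is moved onto \<open>\<phi>''\<close>: with \<open>P'' = S V\<close> and
  \<open>W' = (1 - c) V\<close> it says that \<open>P - \<nu>\<^sup>2 S V - W\<close> is orthogonal to all second derivatives of test
  functions, hence affine with some slope \<open>\<beta>\<close>. This expresses \<open>V\<close> through its primitives, so \<open>V\<close> is
  differentiable off \<open>\<plusminus>\<Xi>\<close>, and \<open>P' - \<beta>\<close> is the flux.\<close>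
lemma flux_of_weak_tw_equation:
  assumes V: "continuous_on UNIV V" and weak: "weak_tw_equation \<nu> \<kappa> S \<Xi> V"
    and "\<nu> \<noteq> 0" "S \<noteq> 0" "\<Xi> > 0"
  obtains Q where "tw_flux \<nu> \<kappa> S \<Xi> V Q"
proof -
  obtain P' where P': "\<And>X. (P' has_real_derivative S * V X) (at X)"
    using continuous_has_primitive[OF continuous_on_mult_left[OF V]] by blast
  have P'c: "continuous_on A P'" for A
    by (rule continuous_at_imp_continuous_on) (use P' DERIV_continuous in blast)
  obtain P where P: "\<And>X. (P has_real_derivative P' X) (at X)"
    using continuous_has_primitive[OF P'c] by blast
  have Pc: "continuous_on A P" for A
    by (rule continuous_at_imp_continuous_on) (use P DERIV_continuous in blast)
  obtain W where Wc: "continuous_on UNIV W"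
    and W: "\<And>X. X \<noteq> -\<Xi> \<Longrightarrow> X \<noteq> \<Xi> \<Longrightarrow> (W has_real_derivative (1 - tw_coeff \<kappa> \<Xi> X) * V X) (at X)"
    using primitive_of_jump[OF V \<open>\<Xi> > 0\<close>] by blast
  define H where "H X = P X - \<nu>\<^sup>2 * S * V X - W X" for X
  have Hc: "continuous_on UNIV H" unfolding H_def by (intro continuous_intros V Wc Pc)
  have "integral UNIV (\<lambda>X. H X * deriv (deriv \<phi>) X) = 0" if \<phi>: "test_function \<phi>" for \<phi>
  proof -
    obtain R where R: "R > 0" "\<And>x. \<bar>x\<bar> > R \<Longrightarrow> \<phi> x = 0 \<and> deriv \<phi> x = 0 \<and> deriv (deriv \<phi>) x = 0"
      using test_function_support[OF \<phi>] by blast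
    note d = test_function_derivatives[OF \<phi>]
    let ?a = "\<lambda>X. S * V X * \<phi> X - \<nu>\<^sup>2 * S * V X * deriv (deriv \<phi>) X"
    let ?b = "\<lambda>X. (V X - tw_coeff \<kappa> \<Xi> X * V X) * deriv \<phi> X"
    let ?h = "\<lambda>X. H X * deriv (deriv \<phi>) X"
    have "((\<lambda>X. ?a X + ?b X - ?h X) has_integral 0) UNIV"
    proof (rule has_integral_derivative_compact_support[of "{-\<Xi>, \<Xi>}" "\<lambda>X. W X * deriv \<phi> X - P X * deriv \<phi> X + P' X * \<phi> X" _ R])
      show "continuous_on UNIV (\<lambda>X. W X * deriv \<phi> X - P X * deriv \<phi> X + P' X * \<phi> X)"
        by (intro continuous_intros Wc Pc P'c d)
      fix X assume X: "X \<notin> {-\<Xi>, \<Xi>}"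
      have "((\<lambda>X. W X * deriv \<phi> X - P X * deriv \<phi> X + P' X * \<phi> X) has_real_derivative
         (W X * deriv (deriv \<phi>) X + (1 - tw_coeff \<kappa> \<Xi> X) * V X * deriv \<phi> X) -
         (P X * deriv (deriv \<phi>) X + P' X * deriv \<phi> X) + (P' X * deriv \<phi> X + S * V X * \<phi> X)) (at X)"
        by (intro DERIV_diff DERIV_add DERIV_mult' P P' W d) (use X in auto)
      also have "(W X * deriv (deriv \<phi>) X + (1 - tw_coeff \<kappa> \<Xi> X) * V X * deriv \<phi> X) -
         (P X * deriv (deriv \<phi>) X + P' X * deriv \<phi> X) + (P' X * deriv \<phi> X + S * V X * \<phi> X) = ?a X + ?b X - ?h X"
        by (simp add: H_def algebra_simps)
      finally show "((\<lambda>X. W X * deriv \<phi> X - P X * deriv \<phi> X + P' X * \<phi> X) has_real_derivative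
         ?a X + ?b X - ?h X) (at X)" .
    qed (use R in auto)
    moreover have a: "(?a has_integral integral UNIV ?a) UNIV"
      by (intro integrable_integral integrable_compact_support[of _ R])
         (use R in \<open>auto intro!: continuous_intros V d\<close>)
    moreover have h: "(?h has_integral integral UNIV ?h) UNIV"
      by (intro integrable_integral integrable_compact_support[of _ R])
         (use R in \<open>auto intro!: continuous_intros Hc d\<close>)
    ultimately have "((\<lambda>X. (?a X + ?b X - ?h X) - ?a X + ?h X) has_integral 0 - integral UNIV ?a + integral UNIV ?h) UNIV"
      by (intro has_integral_diff has_integral_add)
    then have "(?b has_integral - integral UNIV ?a + integral UNIV ?h) UNIV" by simp
    then have "integral UNIV ?b = - integral UNIV ?a + integral UNIV ?h" by (rule integral_unique)
    moreover have "integral UNIV ?a = - integral UNIV ?b"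
      using weak \<phi> unfolding weak_tw_equation_def by blast
    ultimately show "integral UNIV ?h = 0" by linarith
  qed
  then obtain \<alpha> \<beta> where H: "\<And>X. H X = \<alpha> + \<beta> * X"
    using du_Bois_Reymond_second_order[OF Hc] by blast
  have V_eq: "(P X - W X - (\<alpha> + \<beta> * X)) / (\<nu>\<^sup>2 * S) = V X" for X
  proof -
    have "P X - W X - (\<alpha> + \<beta> * X) = \<nu>\<^sup>2 * S * V X" using H[of X] by (simp add: H_def)
    then show ?thesis using assms(3,4) by simp
  qed
  have "tw_flux \<nu> \<kappa> S \<Xi> V (\<lambda>X. P' X - \<beta>)"
    unfolding tw_flux_def
  proof (intro conjI allI impI)
    show "continuous_on UNIV (\<lambda>X. P' X - \<beta>)" by (intro continuous_intros P'c)
    fix X assume X: "X \<noteq> -\<Xi> \<and> X \<noteq> \<Xi>"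
    show "((\<lambda>X. P' X - \<beta>) has_real_derivative S * V X) (at X)"
      using DERIV_diff[OF P'[of X] DERIV_const[of \<beta>]] by simp
    have "((\<lambda>X. (P X - W X - (\<alpha> + \<beta> * X)) / (\<nu>\<^sup>2 * S)) has_real_derivative
        (P' X - (1 - tw_coeff \<kappa> \<Xi> X) * V X - (0 + \<beta> * 1)) / (\<nu>\<^sup>2 * S)) (at X)"
      by (intro DERIV_cdivide DERIV_diff DERIV_add DERIV_const DERIV_cmult DERIV_ident P W) (use X in auto)
    then have "(V has_real_derivative
        (P' X - (1 - tw_coeff \<kappa> \<Xi> X) * V X - (0 + \<beta> * 1)) / (\<nu>\<^sup>2 * S)) (at X)"
      by (rule has_field_derivative_transform_within_open[OF _ open_UNIV UNIV_I V_eq])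
    then show "(V has_real_derivative (P' X - \<beta> - (1 - tw_coeff \<kappa> \<Xi> X) * V X) / (\<nu>\<^sup>2 * S)) (at X)"
      by (rule DERIV_cong) simp
  qed
  then show thesis by (rule that)
qed

section \<open>Linear systems with constant coefficients\<close>

text \<open>The solution of the constant coefficient system \<open>d V' = Q - g V\<close>, \<open>Q' = s V\<close> with data \<open>(v, q)\<close>
  at \<open>x0\<close>. Here \<open>r1\<close> and \<open>r2\<close> are the roots of \<open>d r\<^sup>2 + g r = s\<close>, and \<open>q + d r v\<close> is the
  amplitude at \<open>x0\<close> of the eigenmode \<open>Q + d r V\<close> that evolves like \<open>exp (r x)\<close>.\<close>
definition hom_V :: "real \<Rightarrow> real \<Rightarrow> real \<Rightarrow> real \<Rightarrow> real \<Rightarrow> real \<Rightarrow> real \<Rightarrow> real" where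
  "hom_V d r1 r2 x0 v q x =
     ((q + d * r2 * v) * exp (r2 * (x - x0)) - (q + d * r1 * v) * exp (r1 * (x - x0))) / (d * (r2 - r1))"

definition hom_Q :: "real \<Rightarrow> real \<Rightarrow> real \<Rightarrow> real \<Rightarrow> real \<Rightarrow> real \<Rightarrow> real \<Rightarrow> real" where
  "hom_Q d r1 r2 x0 v q x =
     (r2 * (q + d * r1 * v) * exp (r1 * (x - x0)) - r1 * (q + d * r2 * v) * exp (r2 * (x - x0))) / (r2 - r1)"

lemma hom_initial:
  assumes "d \<noteq> 0" "r1 \<noteq> r2"
  shows "hom_V d r1 r2 x0 v q x0 = v" "hom_Q d r1 r2 x0 v q x0 = q"
  using assms by (simp_all add: hom_V_def hom_Q_def field_simps)

lemma continuous_on_hom: "continuous_on A (hom_V d r1 r2 x0 v q)" "continuous_on A (hom_Q d r1 r2 x0 v q)"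
proof -
  have "continuous_on A (\<lambda>x. ((q + d * r2 * v) * exp (r2 * (x - x0)) - (q + d * r1 * v) * exp (r1 * (x - x0))) * (1 / (d * (r2 - r1))))"
    "continuous_on A (\<lambda>x. (r2 * (q + d * r1 * v) * exp (r1 * (x - x0)) - r1 * (q + d * r2 * v) * exp (r2 * (x - x0))) * (1 / (r2 - r1)))"
    by (intro continuous_intros)+
  then show "continuous_on A (hom_V d r1 r2 x0 v q)" "continuous_on A (hom_Q d r1 r2 x0 v q)"
    by (simp_all add: hom_V_def[abs_def] hom_Q_def[abs_def])
qed

lemma exp_mode_has_derivative:
  "((\<lambda>x. exp (r * (x - x0))) has_real_derivative r * exp (r * (x - x0))) (at (x::real))"
  by (auto intro!: derivative_eq_intros)

lemma hom_solves:
  assumes "d \<noteq> 0" "r1 \<noteq> r2" and sum: "d * (r1 + r2) = - g" and prod: "d * (r1 * r2) = - s"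
  shows "(hom_V d r1 r2 x0 v q has_real_derivative (hom_Q d r1 r2 x0 v q x - g * hom_V d r1 r2 x0 v q x) / d) (at x)"
    and "(hom_Q d r1 r2 x0 v q has_real_derivative s * hom_V d r1 r2 x0 v q x) (at x)"
proof -
  define e1 e2 where "e1 = exp (r1 * (x - x0))" and "e2 = exp (r2 * (x - x0))"
  define E1 E2 where "E1 = q + d * r1 * v" and "E2 = q + d * r2 * v"
  have "(hom_V d r1 r2 x0 v q has_real_derivative (E2 * (r2 * e2) - E1 * (r1 * e1)) / (d * (r2 - r1))) (at x)"
    unfolding hom_V_def[abs_def] e1_def e2_def E1_def E2_def
    by (intro DERIV_cdivide DERIV_diff DERIV_cmult exp_mode_has_derivative)
  also have "(E2 * (r2 * e2) - E1 * (r1 * e1)) / (d * (r2 - r1)) =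
      (hom_Q d r1 r2 x0 v q x - g * hom_V d r1 r2 x0 v q x) / d"
  proof -
    have g: "g = - (d * (r1 + r2))" using sum by simp
    show ?thesis
      unfolding hom_V_def hom_Q_def g e1_def[symmetric] e2_def[symmetric] E1_def[symmetric] E2_def[symmetric]
      using assms(1,2) by (simp add: divide_simps) (simp add: algebra_simps)
  qed
  finally show "(hom_V d r1 r2 x0 v q has_real_derivative (hom_Q d r1 r2 x0 v q x - g * hom_V d r1 r2 x0 v q x) / d) (at x)" .
  have "(hom_Q d r1 r2 x0 v q has_real_derivative (r2 * E1 * (r1 * e1) - r1 * E2 * (r2 * e2)) / (r2 - r1)) (at x)"
    unfolding hom_Q_def[abs_def] e1_def e2_def E1_def E2_def
    by (intro DERIV_cdivide DERIV_diff DERIV_cmult exp_mode_has_derivative)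
  also have "(r2 * E1 * (r1 * e1) - r1 * E2 * (r2 * e2)) / (r2 - r1) = s * hom_V d r1 r2 x0 v q x"
  proof -
    have s: "s = - (d * (r1 * r2))" using prod by simp
    show ?thesis
      unfolding hom_V_def s e1_def[symmetric] e2_def[symmetric] E1_def[symmetric] E2_def[symmetric]
      using assms(1,2) by (simp add: divide_simps) (simp add: algebra_simps)
  qed
  finally show "(hom_Q d r1 r2 x0 v q has_real_derivative s * hom_V d r1 r2 x0 v q x) (at x)" .
qed

text \<open>For a root \<open>r\<close> the combination \<open>M = Q + d r V\<close> satisfies the scalar equation \<open>M' = r M\<close>.
  Only continuity is assumed at the endpoints of the interval, so that the lemma reaches
  the points where \<open>V'\<close> jumps.\<close>
lemma eigenmode_growth:
  fixes V Q :: "real \<Rightarrow> real"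
  assumes cont: "continuous_on {a..b} V" "continuous_on {a..b} Q"
    and Q': "\<And>x. a < x \<Longrightarrow> x < b \<Longrightarrow> (Q has_real_derivative s * V x) (at x)"
    and V': "\<And>x. a < x \<Longrightarrow> x < b \<Longrightarrow> (V has_real_derivative (Q x - g * V x) / d) (at x)"
    and "d \<noteq> 0" and root: "d * r * r + g * r = s"
    and "x0 \<in> {a..b}" "x \<in> {a..b}"
  shows "Q x + d * r * V x = (Q x0 + d * r * V x0) * exp (r * (x - x0))"
proof -
  define M where "M x = (Q x + d * r * V x) * exp (r * (a - x))" for x
  have M': "(M has_real_derivative 0) (at x)" if "a < x" "x < b" for x
  proof -
    have e: "((\<lambda>x. exp (r * (a - x))) has_real_derivative - r * exp (r * (a - x))) (at x)"
      by (auto intro!: derivative_eq_intros)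
    have "(M has_real_derivative (Q x + d * r * V x) * (- r * exp (r * (a - x))) +
        (s * V x + d * r * ((Q x - g * V x) / d)) * exp (r * (a - x))) (at x)"
      unfolding M_def[abs_def] by (intro DERIV_mult' DERIV_add DERIV_cmult e Q' V' that)
    also have "(Q x + d * r * V x) * (- r * exp (r * (a - x))) +
        (s * V x + d * r * ((Q x - g * V x) / d)) * exp (r * (a - x)) = 0"
    proof -
      have "d * r * ((Q x - g * V x) / d) = r * (Q x - g * V x)" using \<open>d \<noteq> 0\<close> by simp
      then show ?thesis by (simp only: root[symmetric]) (simp add: algebra_simps)
    qed
    finally show ?thesis .
  qed
  have Mc: "continuous_on {a..b} M"
    unfolding M_def[abs_def] by (intro continuous_intros cont)
  have M: "M y = M a" if "y \<in> {a..b}" for y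
  proof (cases "y = a")
    case False
    then show ?thesis
      using that by (intro DERIV_isconst_end M' continuous_on_subset[OF Mc]) auto
  qed simp
  have exp_M: "Q y + d * r * V y = M a * exp (r * (y - a))" if "y \<in> {a..b}" for y
  proof -
    have "exp (r * (a - y)) * exp (r * (y - a)) = exp (r * (a - y) + r * (y - a))" by (rule exp_add[symmetric])
    also have "\<dots> = 1" by (simp add: algebra_simps)
    finally have "(Q y + d * r * V y) * exp (r * (a - y)) * exp (r * (y - a)) = Q y + d * r * V y"
      by (simp only: mult.assoc mult_1_right)
    then show ?thesis using M[OF that] by (simp only: M_def)
  qed
  have "exp (r * (x - a)) = exp (r * (x0 - a) + r * (x - x0))" by (simp add: algebra_simps)
  also have "\<dots> = exp (r * (x0 - a)) * exp (r * (x - x0))" by (rule exp_add)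
  finally have e: "exp (r * (x - a)) = exp (r * (x0 - a)) * exp (r * (x - x0))" .
  show ?thesis unfolding exp_M[OF assms(7)] exp_M[OF assms(8)] e by (simp only: mult.assoc)
qed

lemma hom_unique:
  fixes V Q :: "real \<Rightarrow> real"
  assumes cont: "continuous_on {a..b} V" "continuous_on {a..b} Q"
    and Q': "\<And>x. a < x \<Longrightarrow> x < b \<Longrightarrow> (Q has_real_derivative s * V x) (at x)"
    and V': "\<And>x. a < x \<Longrightarrow> x < b \<Longrightarrow> (V has_real_derivative (Q x - g * V x) / d) (at x)"
    and "d \<noteq> 0" "r1 \<noteq> r2" and sum: "d * (r1 + r2) = - g" and prod: "d * (r1 * r2) = - s"
    and x: "x0 \<in> {a..b}" "x \<in> {a..b}"
  shows "V x = hom_V d r1 r2 x0 (V x0) (Q x0) x" "Q x = hom_Q d r1 r2 x0 (V x0) (Q x0) x"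
proof -
  have g: "g = - (d * (r1 + r2))" and s: "s = - (d * (r1 * r2))" using sum prod by simp_all
  have root: "d * r1 * r1 + g * r1 = s" "d * r2 * r2 + g * r2 = s"
    unfolding g s by (simp_all add: algebra_simps)
  have mode: "(Q x0 + d * r * V x0) * exp (r * (x - x0)) = Q x + d * r * V x"
    if "d * r * r + g * r = s" for r
    using eigenmode_growth[OF cont Q' V' \<open>d \<noteq> 0\<close> that x] by simp
  have "hom_V d r1 r2 x0 (V x0) (Q x0) x = ((Q x + d * r2 * V x) - (Q x + d * r1 * V x)) / (d * (r2 - r1))"
    by (simp only: hom_V_def mode[OF root(1)] mode[OF root(2)])
  also have "\<dots> = V x"
    using \<open>d \<noteq> 0\<close> \<open>r1 \<noteq> r2\<close> by (simp add: divide_simps) (simp add: algebra_simps)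
  finally show "V x = hom_V d r1 r2 x0 (V x0) (Q x0) x" ..
  have "hom_Q d r1 r2 x0 (V x0) (Q x0) x =
      (r2 * ((Q x0 + d * r1 * V x0) * exp (r1 * (x - x0))) - r1 * ((Q x0 + d * r2 * V x0) * exp (r2 * (x - x0)))) / (r2 - r1)"
    by (simp only: hom_Q_def mult.assoc)
  also have "\<dots> = (r2 * (Q x + d * r1 * V x) - r1 * (Q x + d * r2 * V x)) / (r2 - r1)"
    by (simp only: mode[OF root(1)] mode[OF root(2)])
  also have "\<dots> = Q x"
    using \<open>r1 \<noteq> r2\<close> by (simp add: divide_simps) (simp add: algebra_simps)
  finally show "Q x = hom_Q d r1 r2 x0 (V x0) (Q x0) x" ..
qed

text \<open>Towards \<open>- \<infinity>\<close> the mode with the smaller rate dominates, so its coefficient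
  carries the sign of the whole combination.\<close>
lemma slow_coefficient_nonneg:
  fixes a b :: real
  assumes "r1 < r2" and nonneg: "\<And>x. x \<le> x0 \<Longrightarrow> a * exp (r1 * x) + b * exp (r2 * x) \<ge> 0"
  shows "a \<ge> 0"
proof -
  have "((\<lambda>x. exp ((r2 - r1) * x)) \<longlongrightarrow> 0) at_bot"
    by (rule filterlim_compose[OF exp_at_bot])
       (use assms(1) in \<open>auto intro!: filterlim_tendsto_pos_mult_at_bot[OF tendsto_const _ filterlim_ident]\<close>)
  then have "((\<lambda>x. a + b * exp ((r2 - r1) * x)) \<longlongrightarrow> a + b * 0) at_bot"
    by (intro tendsto_intros)
  moreover have "a + b * exp ((r2 - r1) * x) \<ge> 0" if "x \<le> x0" for x
  proof -
    have "(a + b * exp ((r2 - r1) * x)) * exp (r1 * x) = a * exp (r1 * x) + b * exp (r2 * x)"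
      by (simp add: algebra_simps flip: exp_add)
    then have "0 \<le> (a + b * exp ((r2 - r1) * x)) * exp (r1 * x)" using nonneg[OF that] by simp
    then show ?thesis by (simp only: zero_le_mult_iff) simp
  qed
  then have "eventually (\<lambda>x. a + b * exp ((r2 - r1) * x) \<ge> 0) at_bot"
    by (auto simp: eventually_at_bot_linorder)
  ultimately show ?thesis
    using tendsto_lowerbound[of "\<lambda>x. a + b * exp ((r2 - r1) * x)" a at_bot 0] by simp
qed

lemma fast_coefficient_nonneg:
  fixes a b :: real
  assumes "r1 < r2" and nonneg: "\<And>x. x \<ge> x0 \<Longrightarrow> a * exp (r1 * x) + b * exp (r2 * x) \<ge> 0"
  shows "b \<ge> 0"
proof (rule slow_coefficient_nonneg[of "- r2" "- r1" "- x0"])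
  show "b * exp (- r2 * x) + a * exp (- r1 * x) \<ge> 0" if "x \<le> - x0" for x
    using nonneg[of "- x"] that by simp
qed (use assms(1) in simp)

lemma hom_V_coefficients:
  "hom_V d r1 r2 x0 v q x =
     - (q + d * r1 * v) * exp (- r1 * x0) / (d * (r2 - r1)) * exp (r1 * x) +
     (q + d * r2 * v) * exp (- r2 * x0) / (d * (r2 - r1)) * exp (r2 * x)"
proof -
  have "exp (r * (x - x0)) = exp (- r * x0) * exp (r * x)" for r
    by (simp add: algebra_simps flip: exp_add)
  moreover define E1 E2 where "E1 = q + d * r1 * v" and "E2 = q + d * r2 * v"
  ultimately show ?thesis
    unfolding hom_V_def E1_def[symmetric] E2_def[symmetric] by (simp add: diff_divide_distrib)
qed

lemma hom_V_nonneg_left: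
  assumes "d > 0" "r1 < r2" and "\<And>x. x \<le> x0 \<Longrightarrow> hom_V d r1 r2 x0 v q x \<ge> 0"
  shows "q + d * r1 * v \<le> 0"
proof (rule ccontr)
  assume neg: "\<not> q + d * r1 * v \<le> 0"
  have "- (q + d * r1 * v) * exp (- r1 * x0) / (d * (r2 - r1)) \<ge> 0"
    by (rule slow_coefficient_nonneg[OF assms(2) assms(3)[unfolded hom_V_coefficients]])
  moreover have "- (q + d * r1 * v) * exp (- r1 * x0) / (d * (r2 - r1)) < 0"
    by (intro divide_neg_pos mult_neg_pos mult_pos_pos) (use neg assms(1,2) in auto)
  ultimately show False by linarith
qed

lemma hom_V_nonneg_right:
  assumes "d > 0" "r1 < r2" and "\<And>x. x \<ge> x0 \<Longrightarrow> hom_V d r1 r2 x0 v q x \<ge> 0"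
  shows "q + d * r2 * v \<ge> 0"
proof (rule ccontr)
  assume neg: "\<not> q + d * r2 * v \<ge> 0"
  have "(q + d * r2 * v) * exp (- r2 * x0) / (d * (r2 - r1)) \<ge> 0"
    by (rule fast_coefficient_nonneg[OF assms(2) assms(3)[unfolded hom_V_coefficients]])
  moreover have "(q + d * r2 * v) * exp (- r2 * x0) / (d * (r2 - r1)) < 0"
    by (intro divide_neg_pos mult_neg_pos mult_pos_pos) (use neg assms(1,2) in auto)
  ultimately show False by linarith
qed

text \<open>Left of \<open>x0\<close> the mode \<open>exp (r1 (x - x0))\<close> exceeds \<open>exp (r2 (x - x0))\<close>; replacing it by the smaller
  one leaves \<open>v exp (r2 (x - x0))\<close> as a positive lower bound. With \<open>hom_V_nonneg_left\<close> this reduces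
  the sign of the profile on a half-line to the sign of one amplitude.\<close>
lemma hom_V_pos_left:
  assumes "d > 0" "r1 < r2" "v > 0" and E: "q + d * r1 * v \<le> 0" and "x \<le> x0"
  shows "hom_V d r1 r2 x0 v q x > 0"
proof -
  have "r2 * (x - x0) \<le> r1 * (x - x0)"
    using assms(2,5) by (simp add: mult_right_mono_neg)
  then have "(q + d * r1 * v) * exp (r1 * (x - x0)) \<le> (q + d * r1 * v) * exp (r2 * (x - x0))"
    using E by (simp add: mult_left_mono_neg)
  moreover have "(q + d * r2 * v) * exp (r2 * (x - x0)) - (q + d * r1 * v) * exp (r2 * (x - x0)) =
      d * (r2 - r1) * v * exp (r2 * (x - x0))" by (simp add: algebra_simps)
  moreover have "d * (r2 - r1) * v * exp (r2 * (x - x0)) > 0" using assms(1-3) by simp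
  ultimately show ?thesis using assms(1,2) by (simp add: hom_V_def)
qed

lemma hom_V_pos_right:
  assumes "d > 0" "r1 < r2" "v > 0" and E: "q + d * r2 * v \<ge> 0" and "x \<ge> x0"
  shows "hom_V d r1 r2 x0 v q x > 0"
proof -
  have "r1 * (x - x0) \<le> r2 * (x - x0)"
    using assms(2,5) by (simp add: mult_right_mono)
  then have "(q + d * r2 * v) * exp (r1 * (x - x0)) \<le> (q + d * r2 * v) * exp (r2 * (x - x0))"
    using E by (simp add: mult_left_mono)
  moreover have "(q + d * r2 * v) * exp (r1 * (x - x0)) - (q + d * r1 * v) * exp (r1 * (x - x0)) =
      d * (r2 - r1) * v * exp (r1 * (x - x0))" by (simp add: algebra_simps)
  moreover have "d * (r2 - r1) * v * exp (r1 * (x - x0)) > 0" using assms(1-3) by simp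
  ultimately show ?thesis using assms(1,2) by (simp add: hom_V_def)
qed

lemma continuous_on_three_pieces:
  fixes f g h :: "real \<Rightarrow> real"
  assumes "continuous_on UNIV f" "continuous_on UNIV g" "continuous_on UNIV h"
    and "f a = g a" "g b = h b" "a \<le> b"
  shows "continuous_on UNIV (\<lambda>x. if x \<le> a then f x else if x \<le> b then g x else h x)"
  by (rule continuous_on_cases_le[OF _ continuous_on_cases_le]; (rule continuous_on_subset[OF assms(1)] continuous_on_subset[OF assms(2)] continuous_on_subset[OF assms(3)] continuous_on_id)?)
     (use assms(4-6) in auto)

section \<open>The exponential rates\<close>

lemma quadratic_roots:
  fixes p q :: real
  assumes "q > 0"
  shows "(- p - sqrt (p\<^sup>2 + q)) + (- p + sqrt (p\<^sup>2 + q)) = - 2 * p"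
    and "(- p - sqrt (p\<^sup>2 + q)) * (- p + sqrt (p\<^sup>2 + q)) = - q"
    and "- p - sqrt (p\<^sup>2 + q) < 0" "- p + sqrt (p\<^sup>2 + q) > 0"
proof -
  have "\<bar>p\<bar> < sqrt (p\<^sup>2 + q)" using assms by (intro real_less_rsqrt) auto
  then show "- p - sqrt (p\<^sup>2 + q) < 0" "- p + sqrt (p\<^sup>2 + q) > 0" by auto
  have "(- p - sqrt (p\<^sup>2 + q)) * (- p + sqrt (p\<^sup>2 + q)) = p\<^sup>2 - (sqrt (p\<^sup>2 + q))\<^sup>2"
    by (simp add: power2_eq_square algebra_simps)
  then show "(- p - sqrt (p\<^sup>2 + q)) * (- p + sqrt (p\<^sup>2 + q)) = - q"
    using assms by (simp add: add_nonneg_pos)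
qed simp

locale tw_parameters =
  fixes \<nu> \<kappa> S \<Xi> :: real
  assumes pos: "\<nu> > 0" "0 < \<kappa>" "\<kappa> < 1" "S > 0" "\<Xi> > 0"
begin

abbreviation "d \<equiv> \<nu>\<^sup>2 * S"
abbreviation "lm \<equiv> lambda_minus \<nu> S"
abbreviation "lp \<equiv> lambda_plus \<nu> S"
abbreviation "mm \<equiv> mu_minus \<nu> \<kappa> S"
abbreviation "mp \<equiv> mu_plus \<nu> \<kappa> S"

lemma d_pos: "d > 0" using pos by simp

lemma lambda_relations: "d * (lm + lp) = - 1" "d * (lm * lp) = - S" "lm < 0" "0 < lp"
proof -
  have q: "1 / \<nu>\<^sup>2 > 0" using pos by simp
  note r = quadratic_roots[OF q, of "1 / (2 * \<nu>\<^sup>2 * S)", folded lambda_minus_def lambda_plus_def]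
  show "lm < 0" "0 < lp" by (fact r)+
  show "d * (lm + lp) = - 1" "d * (lm * lp) = - S" unfolding r using pos by simp_all
qed

lemma mu_relations: "d * (mm + mp) = - (1 - 1 / \<kappa>)" "d * (mm * mp) = - S" "mm < 0" "0 < mp"
proof -
  have q: "1 / \<nu>\<^sup>2 > 0" using pos by simp
  note r = quadratic_roots[OF q, of "- ((1 - \<kappa>) / (2 * \<nu>\<^sup>2 * S * \<kappa>))", unfolded minus_minus power2_minus,
      folded mu_minus_def mu_plus_def]
  show "mm < 0" "0 < mp" by (fact r)+
  show "d * (mm + mp) = - (1 - 1 / \<kappa>)" "d * (mm * mp) = - S" unfolding r using pos by (simp_all add: field_simps)
qed

text \<open>The sums \<open>\<lambda>\<^sub>- + \<lambda>\<^sub>+\<close> and \<open>\<mu>\<^sub>- + \<mu>\<^sub>+\<close> differ by exactly \<open>1 / (\<nu>\<^sup>2 S \<kappa>)\<close>, the factor in the jump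
  conditions, so each \<open>\<tau>\<close> is a plain difference of two rates.\<close>
lemma tau_eq:
  "tau_mm \<nu> \<kappa> S = lp - mp" "tau_mp \<nu> \<kappa> S = lp - mm"
  "tau_pm \<nu> \<kappa> S = lm - mp" "tau_pp \<nu> \<kappa> S = lm - mm"
proof -
  have "d * (lm + lp) + 1 / \<kappa> = d * (mm + mp)" using lambda_relations(1) mu_relations(1) by simp
  then have "lm + lp + 1 / (d * \<kappa>) = mm + mp"
    using d_pos pos by (simp add: field_simps)
  then show "tau_mm \<nu> \<kappa> S = lp - mp" "tau_mp \<nu> \<kappa> S = lp - mm"
    "tau_pm \<nu> \<kappa> S = lm - mp" "tau_pp \<nu> \<kappa> S = lm - mm"
    unfolding tau_mm_def tau_mp_def tau_pm_def tau_pp_def by linarith+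
qed

text \<open>The products \<open>\<lambda>\<^sub>- \<lambda>\<^sub>+\<close> and \<open>\<mu>\<^sub>- \<mu>\<^sub>+\<close> agree, so the two characteristic polynomials differ by the
  monomial \<open>x / (\<nu>\<^sup>2 S \<kappa>)\<close>. At the roots \<open>\<mu>\<^sub>\<plusminus>\<close> the polynomial of the outer rates thus
  has the sign of \<open>\<mu>\<^sub>\<plusminus>\<close>, which locates them between and above its roots. In particular
  \<open>\<tau>\<^sub>-\<^sub>+\<close> is positive and the other three \<open>\<tau>\<close> are negative.\<close>
lemma rates_interlace: "lm < mm" "mm < lp" "lm < mp" "lp < mp" "mm < mp"
proof -
  show 1: "mm < lp" "lm < mp" "mm < mp" using lambda_relations mu_relations by linarith+
  have lam: "lm + lp = mm + mp - 1 / (d * \<kappa>)"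
    using tau_eq(1) unfolding tau_mm_def by linarith
  have "d * (lm * lp) = d * (mm * mp)" using lambda_relations(2) mu_relations(2) by simp
  then have prod: "lm * lp = mm * mp" using pos by simp
  have val: "(x - lm) * (x - lp) = x / (d * \<kappa>)" if "(x - mm) * (x - mp) = 0" for x
  proof -
    have "(x - lm) * (x - lp) = x * x - (lm + lp) * x + lm * lp" by (simp add: algebra_simps)
    also have "\<dots> = (x - mm) * (x - mp) + x / (d * \<kappa>)" unfolding lam prod by (simp add: algebra_simps)
    finally show ?thesis using that by simp
  qed
  have dk: "d * \<kappa> > 0" using d_pos pos by simp
  have "(mm - lm) * (mm - lp) < 0"
    using val[of mm] divide_neg_pos[OF mu_relations(3) dk] by simp
  then show "lm < mm" using 1 by (simp add: mult_less_0_iff)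
  have "(mp - lm) * (mp - lp) > 0"
    using val[of mp] divide_pos_pos[OF mu_relations(4) dk] by simp
  then show "lp < mp" using 1 by (simp add: zero_less_mult_iff)
qed

section \<open>Profiles determined by the inner coefficients\<close>

definition mid_V :: "real \<Rightarrow> real \<Rightarrow> real \<Rightarrow> real" where
  "mid_V Bm Bp X = Bm * exp (mm * X) + Bp * exp (mp * X)"

text \<open>The flux \<open>d V' + (1 - 1 / \<kappa>) V\<close> of \<open>mid_V\<close>; each factor \<open>d \<mu>\<^sub>\<mp> + 1 - 1 / \<kappa>\<close> has been
  replaced by \<open>- d \<mu>\<^sub>\<plusminus>\<close>, using the sum of the two rates.\<close>
definition mid_Q :: "real \<Rightarrow> real \<Rightarrow> real \<Rightarrow> real" where
  "mid_Q Bm Bp X = - d * (mp * Bm * exp (mm * X) + mm * Bp * exp (mp * X))"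

text \<open>The inner coefficients determine the whole wave: value and flux at \<open>\<plusminus>\<Xi>\<close> are the initial data
  for the outer pieces.\<close>
definition profile_V :: "real \<Rightarrow> real \<Rightarrow> real \<Rightarrow> real" where
  "profile_V Bm Bp X =
     (if X \<le> - \<Xi> then hom_V d lm lp (- \<Xi>) (mid_V Bm Bp (- \<Xi>)) (mid_Q Bm Bp (- \<Xi>)) X
      else if X \<le> \<Xi> then mid_V Bm Bp X
      else hom_V d lm lp \<Xi> (mid_V Bm Bp \<Xi>) (mid_Q Bm Bp \<Xi>) X)"

definition profile_Q :: "real \<Rightarrow> real \<Rightarrow> real \<Rightarrow> real" where
  "profile_Q Bm Bp X =
     (if X \<le> - \<Xi> then hom_Q d lm lp (- \<Xi>) (mid_V Bm Bp (- \<Xi>)) (mid_Q Bm Bp (- \<Xi>)) X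
      else if X \<le> \<Xi> then mid_Q Bm Bp X
      else hom_Q d lm lp \<Xi> (mid_V Bm Bp \<Xi>) (mid_Q Bm Bp \<Xi>) X)"

text \<open>Every solution of the inner system has the exponential form with some pair of coefficients.\<close>
lemma hom_eq_mid:
  defines "Bm v q \<equiv> - (q + d * mm * v) * exp (- mm * (- \<Xi>)) / (d * (mp - mm))"
    and "Bp v q \<equiv> (q + d * mp * v) * exp (- mp * (- \<Xi>)) / (d * (mp - mm))"
  shows "hom_V d mm mp (- \<Xi>) v q X = mid_V (Bm v q) (Bp v q) X"
    and "hom_Q d mm mp (- \<Xi>) v q X = mid_Q (Bm v q) (Bp v q) X"
proof -
  show "hom_V d mm mp (- \<Xi>) v q X = mid_V (Bm v q) (Bp v q) X"
    by (simp only: mid_V_def Bm_def Bp_def hom_V_coefficients)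
  have e: "exp (r * (X - (- \<Xi>))) = exp (- r * (- \<Xi>)) * exp (r * X)" for r
    by (simp add: algebra_simps flip: exp_add)
  have alg: "(p * N1 * (e1 * E1) - m * N2 * (e2 * E2)) / D =
      - c * (p * (- N1 * e1 / (c * D)) * E1 + m * (N2 * e2 / (c * D)) * E2)"
    if "c \<noteq> 0" "D \<noteq> 0" for p m N1 N2 e1 e2 E1 E2 c D :: real
    using that by (simp add: field_simps)
  show "hom_Q d mm mp (- \<Xi>) v q X = mid_Q (Bm v q) (Bp v q) X"
    unfolding hom_Q_def mid_Q_def Bm_def Bp_def e
    by (rule alg) (use pos rates_interlace(5) in auto)
qed

lemma mid_derivative:
  "(mid_V Bm Bp has_real_derivative (mid_Q Bm Bp X - (1 - 1 / \<kappa>) * mid_V Bm Bp X) / d) (at X)"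
  "(mid_Q Bm Bp has_real_derivative S * mid_V Bm Bp X) (at X)"
proof -
  have e: "((\<lambda>x. exp (r * x)) has_real_derivative r * exp (r * X)) (at X)" for r
    using exp_mode_has_derivative[of r 0 X] by simp
  have "(mid_V Bm Bp has_real_derivative Bm * (mm * exp (mm * X)) + Bp * (mp * exp (mp * X))) (at X)"
    unfolding mid_V_def[abs_def] by (intro DERIV_add DERIV_cmult e)
  also have "Bm * (mm * exp (mm * X)) + Bp * (mp * exp (mp * X)) = (mid_Q Bm Bp X - (1 - 1 / \<kappa>) * mid_V Bm Bp X) / d"
  proof -
    have "mid_Q Bm Bp X - (1 - 1 / \<kappa>) * mid_V Bm Bp X = mid_Q Bm Bp X + d * (mm + mp) * mid_V Bm Bp X"
      unfolding mu_relations(1) by (simp add: algebra_simps)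
    also have "\<dots> = d * (Bm * (mm * exp (mm * X)) + Bp * (mp * exp (mp * X)))"
      by (simp add: mid_Q_def mid_V_def algebra_simps)
    finally show ?thesis using pos by simp
  qed
  finally show "(mid_V Bm Bp has_real_derivative (mid_Q Bm Bp X - (1 - 1 / \<kappa>) * mid_V Bm Bp X) / d) (at X)" .
  have "(mid_Q Bm Bp has_real_derivative - d * (mp * Bm * (mm * exp (mm * X)) + mm * Bp * (mp * exp (mp * X)))) (at X)"
    unfolding mid_Q_def[abs_def] by (intro DERIV_add DERIV_cmult e)
  also have "- d * (mp * Bm * (mm * exp (mm * X)) + mm * Bp * (mp * exp (mp * X))) = - (d * (mm * mp)) * mid_V Bm Bp X"
    by (simp add: mid_V_def algebra_simps)
  also have "\<dots> = S * mid_V Bm Bp X" unfolding mu_relations(2) by simp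
  finally show "(mid_Q Bm Bp has_real_derivative S * mid_V Bm Bp X) (at X)" .
qed

lemma continuous_mid: "continuous_on A (mid_V Bm Bp)" "continuous_on A (mid_Q Bm Bp)"
  using mid_derivative by (meson DERIV_continuous continuous_at_imp_continuous_on)+

lemma continuous_profile: "continuous_on UNIV (profile_V Bm Bp)" "continuous_on UNIV (profile_Q Bm Bp)"
proof -
  have ne: "d \<noteq> 0" "lm \<noteq> lp" using d_pos lambda_relations by auto
  show "continuous_on UNIV (profile_V Bm Bp)" "continuous_on UNIV (profile_Q Bm Bp)"
    unfolding profile_V_def[abs_def] profile_Q_def[abs_def]
    by (intro continuous_on_three_pieces continuous_on_hom continuous_mid; use hom_initial[OF ne] pos in simp)+
qed

lemma profile_flux: "tw_flux \<nu> \<kappa> S \<Xi> (profile_V Bm Bp) (profile_Q Bm Bp)"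
  unfolding tw_flux_def
proof (intro conjI allI impI)
  show "continuous_on UNIV (profile_Q Bm Bp)" by (rule continuous_profile)
  have ne: "d \<noteq> 0" "lm \<noteq> lp" using d_pos lambda_relations by auto
  fix X assume X: "X \<noteq> - \<Xi> \<and> X \<noteq> \<Xi>"
  then consider "X < -\<Xi>" | "-\<Xi> < X" "X < \<Xi>" | "X > \<Xi>" by linarith
  then have "(profile_Q Bm Bp has_real_derivative S * profile_V Bm Bp X) (at X) \<and>
    (profile_V Bm Bp has_real_derivative (profile_Q Bm Bp X - (1 - tw_coeff \<kappa> \<Xi> X) * profile_V Bm Bp X) / d) (at X)"
  proof cases
    case 1
    have eq: "hom_V d lm lp (- \<Xi>) (mid_V Bm Bp (- \<Xi>)) (mid_Q Bm Bp (- \<Xi>)) x = profile_V Bm Bp x"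
      "hom_Q d lm lp (- \<Xi>) (mid_V Bm Bp (- \<Xi>)) (mid_Q Bm Bp (- \<Xi>)) x = profile_Q Bm Bp x" if "x \<in> {..<-\<Xi>}" for x
      using that by (simp_all add: profile_V_def profile_Q_def)
    have c: "1 - tw_coeff \<kappa> \<Xi> X = 1" using 1 by (simp add: tw_coeff_def)
    note h = hom_solves[OF ne lambda_relations(1,2), of "-\<Xi>" "mid_V Bm Bp (- \<Xi>)" "mid_Q Bm Bp (- \<Xi>)" X]
    show ?thesis
      unfolding c using 1 h[unfolded eq[of X, simplified, OF 1]]
      by (auto intro: has_field_derivative_transform_within_open[where S="{..<-\<Xi>}"] eq)
  next
    case 2
    have eq: "mid_V Bm Bp x = profile_V Bm Bp x" "mid_Q Bm Bp x = profile_Q Bm Bp x" if "x \<in> {-\<Xi><..<\<Xi>}" for x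
      using that by (simp_all add: profile_V_def profile_Q_def)
    have c: "tw_coeff \<kappa> \<Xi> X = 1 / \<kappa>" using 2 by (simp add: tw_coeff_def)
    have X: "X \<in> {-\<Xi><..<\<Xi>}" using 2 by simp
    show ?thesis
      unfolding c using X mid_derivative[of Bm Bp X, unfolded eq[OF X]]
      by (auto intro: has_field_derivative_transform_within_open[where S="{-\<Xi><..<\<Xi>}"] eq)
  next
    case 3
    have eq: "hom_V d lm lp \<Xi> (mid_V Bm Bp \<Xi>) (mid_Q Bm Bp \<Xi>) x = profile_V Bm Bp x"
      "hom_Q d lm lp \<Xi> (mid_V Bm Bp \<Xi>) (mid_Q Bm Bp \<Xi>) x = profile_Q Bm Bp x" if "x \<in> {\<Xi><..}" for x
      using that pos by (simp_all add: profile_V_def profile_Q_def)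
    have c: "1 - tw_coeff \<kappa> \<Xi> X = 1" using 3 by (simp add: tw_coeff_def)
    note h = hom_solves[OF ne lambda_relations(1,2), of \<Xi> "mid_V Bm Bp \<Xi>" "mid_Q Bm Bp \<Xi>" X]
    show ?thesis
      unfolding c using 3 h[unfolded eq[of X, simplified, OF 3]]
      by (auto intro: has_field_derivative_transform_within_open[where S="{\<Xi><..}"] eq)
  qed
  then show "(profile_Q Bm Bp has_real_derivative S * profile_V Bm Bp X) (at X)"
    "(profile_V Bm Bp has_real_derivative (profile_Q Bm Bp X - (1 - tw_coeff \<kappa> \<Xi> X) * profile_V Bm Bp X) / d) (at X)"
    by auto
qed

lemma flux_is_profile:
  assumes V: "continuous_on UNIV V" and flux: "tw_flux \<nu> \<kappa> S \<Xi> V Q"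
  obtains Bm Bp where "V = profile_V Bm Bp"
proof -
  have Q: "continuous_on UNIV Q" using flux by (simp add: tw_flux_def)
  note cont = continuous_on_subset[OF V subset_UNIV] continuous_on_subset[OF Q subset_UNIV]
  have outer: "V X = hom_V d lm lp x0 (V x0) (Q x0) X"
    if ab: "b \<le> - \<Xi> \<or> \<Xi> \<le> a" and x: "x0 \<in> {a..b}" "X \<in> {a..b}" for a b x0 X
  proof (rule hom_unique(1)[OF cont _ _ _ _ lambda_relations(1,2) x])
    fix x assume x: "a < x" "x < b"
    then have "x \<noteq> - \<Xi> \<and> x \<noteq> \<Xi>" and c: "tw_coeff \<kappa> \<Xi> x = 0"
      using ab pos by (auto simp: tw_coeff_def)
    then show "(Q has_real_derivative S * V x) (at x)" "(V has_real_derivative (Q x - 1 * V x) / d) (at x)"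
      using flux by (auto simp: tw_flux_def)
  qed (use d_pos lambda_relations in auto)
  have inner: "V X = hom_V d mm mp (- \<Xi>) (V (- \<Xi>)) (Q (- \<Xi>)) X \<and> Q X = hom_Q d mm mp (- \<Xi>) (V (- \<Xi>)) (Q (- \<Xi>)) X"
    if X: "X \<in> {-\<Xi>..\<Xi>}" for X
  proof -
    have "(Q has_real_derivative S * V x) (at x)" "(V has_real_derivative (Q x - (1 - 1 / \<kappa>) * V x) / d) (at x)"
      if x: "- \<Xi> < x" "x < \<Xi>" for x
    proof -
      have "x \<noteq> - \<Xi> \<and> x \<noteq> \<Xi>" "tw_coeff \<kappa> \<Xi> x = 1 / \<kappa>"
        using x by (auto simp: tw_coeff_def)
      then show "(Q has_real_derivative S * V x) (at x)" "(V has_real_derivative (Q x - (1 - 1 / \<kappa>) * V x) / d) (at x)"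
        using flux unfolding tw_flux_def by metis+
    qed
    note h = hom_unique[OF cont this _ _ mu_relations(1,2) _ X, of "-\<Xi>"]
    show ?thesis using h d_pos mu_relations pos by auto
  qed
  define Bm where "Bm = - (Q (- \<Xi>) + d * mm * V (- \<Xi>)) * exp (- mm * (- \<Xi>)) / (d * (mp - mm))"
  define Bp where "Bp = (Q (- \<Xi>) + d * mp * V (- \<Xi>)) * exp (- mp * (- \<Xi>)) / (d * (mp - mm))"
  have mid: "V X = mid_V Bm Bp X" "Q X = mid_Q Bm Bp X" if "X \<in> {-\<Xi>..\<Xi>}" for X
    using inner[OF that] hom_eq_mid[of "V (- \<Xi>)" "Q (- \<Xi>)" X] unfolding Bm_def Bp_def by metis+
  have "V X = profile_V Bm Bp X" for X
  proof -
    have ends: "V (- \<Xi>) = mid_V Bm Bp (- \<Xi>)" "Q (- \<Xi>) = mid_Q Bm Bp (- \<Xi>)"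
      "V \<Xi> = mid_V Bm Bp \<Xi>" "Q \<Xi> = mid_Q Bm Bp \<Xi>"
      using mid pos by auto
    consider "X \<le> - \<Xi>" | "- \<Xi> < X" "X \<le> \<Xi>" | "\<Xi> < X" by linarith
    then show ?thesis
    proof cases
      case 1
      then show ?thesis using outer[of "- \<Xi>" X "- \<Xi>" X] by (simp add: profile_V_def ends)
    next
      case 2
      then show ?thesis using mid[of X] by (simp add: profile_V_def)
    next
      case 3
      then show ?thesis using outer[of X \<Xi> \<Xi> X] pos by (simp add: profile_V_def ends)
    qed
  qed
  then show thesis by (intro that[of Bm Bp]) auto
qed

section \<open>Nonnegative profiles and the admissible ratios\<close>

definition sigma_min :: real where
  "sigma_min = - (tau_pp \<nu> \<kappa> S / tau_pm \<nu> \<kappa> S) * exp (- ((mp - mm) * \<Xi>))"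

definition sigma_max :: real where
  "sigma_max = - (tau_mp \<nu> \<kappa> S / tau_mm \<nu> \<kappa> S) * exp ((mp - mm) * \<Xi>)"

lemma sigma_range_eq: "sigma_range \<nu> \<kappa> S \<Xi> = {sigma_min..sigma_max}"
  by (simp add: sigma_range_def sigma_min_def sigma_max_def)

lemma sigma_min_neg: "sigma_min < 0" and sigma_max_pos: "sigma_max > 0"
proof -
  have "(lm - mm) / (lm - mp) > 0" "(lp - mm) / (lp - mp) < 0"
    using rates_interlace by (auto intro: divide_neg_neg divide_pos_neg)
  then show "sigma_min < 0" "sigma_max > 0" unfolding sigma_min_def sigma_max_def tau_eq
    by (auto intro!: mult_neg_pos mult_pos_pos simp del: times_divide_eq_left)
qed

text \<open>In terms of the inner coefficients the amplitude of the mode \<open>\<lambda>\<^sub>-\<close> at \<open>- \<Xi>\<close> is proportional to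
  \<open>\<tau>\<^sub>+\<^sub>- B\<^sub>- exp (- \<mu>\<^sub>- \<Xi>) + \<tau>\<^sub>+\<^sub>+ B\<^sub>+ exp (- \<mu>\<^sub>+ \<Xi>)\<close>, and \<open>A\<^sub>-\<close> is a negative multiple of it. Dividing by \<open>\<tau>\<^sub>+\<^sub>- < 0\<close>
  reverses the inequality and produces the lower end of the range.\<close>
lemma left_amplitude_sign:
  "mid_Q Bm Bp (- \<Xi>) + d * lm * mid_V Bm Bp (- \<Xi>) \<le> 0 \<longleftrightarrow> sigma_min * Bp \<le> Bm"
proof -
  define e where "e = exp (- ((mp - mm) * \<Xi>))"
  have e: "exp (mp * (- \<Xi>)) = e * exp (mm * (- \<Xi>))"
    unfolding e_def by (simp add: algebra_simps flip: exp_add)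
  have neg: "lm - mp < 0" using rates_interlace by simp
  have "mid_Q Bm Bp (- \<Xi>) + d * lm * mid_V Bm Bp (- \<Xi>) =
      d * exp (mm * (- \<Xi>)) * ((lm - mp) * Bm + (lm - mm) * e * Bp)"
    unfolding mid_Q_def mid_V_def e by (simp add: algebra_simps)
  also have "\<dots> \<le> 0 \<longleftrightarrow> (lm - mp) * Bm + (lm - mm) * e * Bp \<le> 0"
  proof -
    have "d * exp (mm * (- \<Xi>)) > 0" by (rule mult_pos_pos[OF d_pos exp_gt_zero])
    moreover have "c * x \<le> 0 \<longleftrightarrow> x \<le> 0" if "c > 0" for c x :: real
      using that by (auto simp: mult_le_0_iff)
    ultimately show ?thesis by blast
  qed
  also have "(lm - mp) * Bm + (lm - mm) * e * Bp = (lm - mp) * (Bm - - ((lm - mm) / (lm - mp)) * e * Bp)"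
    using neg by (simp add: field_simps)
  also have "\<dots> \<le> 0 \<longleftrightarrow> 0 \<le> Bm - - ((lm - mm) / (lm - mp)) * e * Bp"
    using neg by (simp only: mult_le_0_iff) linarith
  also have "\<dots> \<longleftrightarrow> sigma_min * Bp \<le> Bm"
    unfolding sigma_min_def tau_eq e_def by (rule diff_ge_0_iff_ge)
  finally show ?thesis .
qed

text \<open>Mirror image at \<open>\<Xi>\<close>: \<open>C\<^sub>+\<close> is a positive multiple of
  \<open>\<tau>\<^sub>-\<^sub>- B\<^sub>- exp (\<mu>\<^sub>- \<Xi>) + \<tau>\<^sub>-\<^sub>+ B\<^sub>+ exp (\<mu>\<^sub>+ \<Xi>)\<close>, and dividing by \<open>\<tau>\<^sub>-\<^sub>- < 0\<close> gives the upper end.\<close>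
lemma right_amplitude_sign:
  "mid_Q Bm Bp \<Xi> + d * lp * mid_V Bm Bp \<Xi> \<ge> 0 \<longleftrightarrow> Bm \<le> sigma_max * Bp"
proof -
  define e where "e = exp ((mp - mm) * \<Xi>)"
  have e: "exp (mp * \<Xi>) = e * exp (mm * \<Xi>)"
    unfolding e_def by (simp add: algebra_simps flip: exp_add)
  have neg: "lp - mp < 0" using rates_interlace by simp
  have "mid_Q Bm Bp \<Xi> + d * lp * mid_V Bm Bp \<Xi> =
      d * exp (mm * \<Xi>) * ((lp - mp) * Bm + (lp - mm) * e * Bp)"
    unfolding mid_Q_def mid_V_def e by (simp add: algebra_simps)
  also have "0 \<le> \<dots> \<longleftrightarrow> 0 \<le> (lp - mp) * Bm + (lp - mm) * e * Bp"
  proof -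
    have "d * exp (mm * \<Xi>) > 0" by (rule mult_pos_pos[OF d_pos exp_gt_zero])
    moreover have "0 \<le> c * x \<longleftrightarrow> 0 \<le> x" if "c > 0" for c x :: real
      using that by (auto simp: zero_le_mult_iff)
    ultimately show ?thesis by blast
  qed
  also have "(lp - mp) * Bm + (lp - mm) * e * Bp = (lp - mp) * (Bm - - ((lp - mm) / (lp - mp)) * e * Bp)"
    using neg by (simp add: field_simps)
  also have "0 \<le> \<dots> \<longleftrightarrow> Bm - - ((lp - mm) / (lp - mp)) * e * Bp \<le> 0"
    using neg by (simp only: zero_le_mult_iff) linarith
  also have "\<dots> \<longleftrightarrow> Bm \<le> sigma_max * Bp"
    unfolding sigma_max_def tau_eq e_def by (rule diff_le_0_iff_le)
  finally show ?thesis .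
qed

lemma profile_mid: "X \<in> {-\<Xi>..\<Xi>} \<Longrightarrow> profile_V Bm Bp X = mid_V Bm Bp X"
proof -
  have ne: "d \<noteq> 0" "lm \<noteq> lp" using d_pos lambda_relations by auto
  show "X \<in> {-\<Xi>..\<Xi>} \<Longrightarrow> profile_V Bm Bp X = mid_V Bm Bp X"
    using hom_initial[OF ne] by (auto simp: profile_V_def)
qed

lemma profile_nonneg_imp:
  assumes "\<And>X. profile_V Bm Bp X \<ge> 0"
  shows "sigma_min * Bp \<le> Bm" "Bm \<le> sigma_max * Bp"
proof -
  have rates: "lm < lp" using lambda_relations by simp
  have ne: "d \<noteq> 0" "lm \<noteq> lp" using d_pos rates by auto
  have "mid_Q Bm Bp (- \<Xi>) + d * lm * mid_V Bm Bp (- \<Xi>) \<le> 0"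
  proof (rule hom_V_nonneg_left[OF d_pos rates, of "- \<Xi>"])
    fix X assume "X \<le> - \<Xi>"
    then have "hom_V d lm lp (- \<Xi>) (mid_V Bm Bp (- \<Xi>)) (mid_Q Bm Bp (- \<Xi>)) X = profile_V Bm Bp X"
      by (simp add: profile_V_def)
    then show "0 \<le> hom_V d lm lp (- \<Xi>) (mid_V Bm Bp (- \<Xi>)) (mid_Q Bm Bp (- \<Xi>)) X" using assms by simp
  qed
  then show "sigma_min * Bp \<le> Bm" by (simp only: left_amplitude_sign)
  have "mid_Q Bm Bp \<Xi> + d * lp * mid_V Bm Bp \<Xi> \<ge> 0"
  proof (rule hom_V_nonneg_right[OF d_pos rates, of \<Xi>])
    fix X assume "\<Xi> \<le> X"
    then have "hom_V d lm lp \<Xi> (mid_V Bm Bp \<Xi>) (mid_Q Bm Bp \<Xi>) X = profile_V Bm Bp X"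
      using pos hom_initial[OF ne] by (auto simp: profile_V_def)
    then show "0 \<le> hom_V d lm lp \<Xi> (mid_V Bm Bp \<Xi>) (mid_Q Bm Bp \<Xi>) X" using assms by simp
  qed
  then show "Bm \<le> sigma_max * Bp" by (simp only: right_amplitude_sign)
qed

text \<open>\<open>exp ((\<mu>\<^sub>+ - \<mu>\<^sub>-) X)\<close> is smallest at \<open>X = - \<Xi>\<close>, and there it beats \<open>- sigma_min\<close> because
  \<open>\<tau>\<^sub>+\<^sub>+ / \<tau>\<^sub>+\<^sub>- < 1\<close>.\<close>
lemma mid_pos:
  assumes "Bp > 0" "sigma_min * Bp \<le> Bm" "X \<ge> - \<Xi>"
  shows "mid_V Bm Bp X > 0"
proof -
  have "(lm - mm) / (lm - mp) < 1"
    using rates_interlace by (simp add: divide_less_eq)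
  then have r: "tau_pp \<nu> \<kappa> S / tau_pm \<nu> \<kappa> S < 1" unfolding tau_eq .
  have "(mp - mm) * (- \<Xi>) \<le> (mp - mm) * X"
    using rates_interlace(5) assms(3) by (intro mult_left_mono) auto
  then have "exp (- ((mp - mm) * \<Xi>)) \<le> exp ((mp - mm) * X)" by (simp only: exp_le_cancel_iff)
  moreover have "tau_pp \<nu> \<kappa> S / tau_pm \<nu> \<kappa> S * exp (- ((mp - mm) * \<Xi>)) < exp (- ((mp - mm) * \<Xi>))"
    using mult_strict_right_mono[OF r exp_gt_zero, of "- ((mp - mm) * \<Xi>)"] by (simp only: mult_1)
  ultimately have "0 < sigma_min + exp ((mp - mm) * X)"
    unfolding sigma_min_def mult_minus_left by linarith
  then have "0 < (sigma_min + exp ((mp - mm) * X)) * Bp" using assms(1) by (rule mult_pos_pos)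
  also have "\<dots> \<le> Bm + exp ((mp - mm) * X) * Bp" using assms(2) by (simp only: distrib_right)
  finally have "0 < exp (mm * X) * (Bm + exp ((mp - mm) * X) * Bp)" by simp
  also have "\<dots> = mid_V Bm Bp X" by (simp add: mid_V_def algebra_simps flip: exp_add)
  finally show ?thesis .
qed

lemma profile_pos:
  assumes "Bp > 0" "sigma_min * Bp \<le> Bm" "Bm \<le> sigma_max * Bp"
  shows "profile_V Bm Bp X > 0"
proof -
  have rates: "lm < lp" using lambda_relations by simp
  have "mid_Q Bm Bp (- \<Xi>) + d * lm * mid_V Bm Bp (- \<Xi>) \<le> 0"
    "mid_Q Bm Bp \<Xi> + d * lp * mid_V Bm Bp \<Xi> \<ge> 0"
    using assms by (simp_all only: left_amplitude_sign right_amplitude_sign)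
  moreover have "mid_V Bm Bp (- \<Xi>) > 0" "mid_V Bm Bp \<Xi> > 0"
    using mid_pos[OF assms(1,2)] pos by auto
  ultimately show ?thesis
    using hom_V_pos_left[OF d_pos rates] hom_V_pos_right[OF d_pos rates] mid_pos[OF assms(1,2)]
    by (auto simp: profile_V_def)
qed

lemma profile_coefficients: "\<exists>Am Ap Cm Cp. tw_coefficients \<nu> \<kappa> S \<Xi> (profile_V Bm Bp) Am Ap Bm Bp Cm Cp"
proof -
  have ne: "d \<noteq> 0" "lm \<noteq> lp" using d_pos lambda_relations by auto
  have "profile_V Bm Bp X = hom_V d lm lp \<Xi> (mid_V Bm Bp \<Xi>) (mid_Q Bm Bp \<Xi>) X" if "X \<ge> \<Xi>" for X
    using that pos hom_initial[OF ne] by (auto simp: profile_V_def)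
  moreover have "profile_V Bm Bp X = hom_V d lm lp (- \<Xi>) (mid_V Bm Bp (- \<Xi>)) (mid_Q Bm Bp (- \<Xi>)) X" if "X \<le> - \<Xi>" for X
    using that by (simp add: profile_V_def)
  ultimately show ?thesis
    unfolding tw_coefficients_def
    using profile_mid[of _ Bm Bp] by (intro exI conjI ballI) (auto simp only: hom_V_coefficients mid_V_def atMost_iff atLeast_iff)
qed

lemma mid_coefficients_unique:
  assumes "tw_coefficients \<nu> \<kappa> S \<Xi> (profile_V Bm Bp) Am Ap Bm' Bp' Cm Cp"
  shows "Bm' = Bm" "Bp' = Bp"
proof -
  have eq: "Bm * exp (mm * X) + Bp * exp (mp * X) = Bm' * exp (mm * X) + Bp' * exp (mp * X)"
    if "X \<in> {-\<Xi>..\<Xi>}" for X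
    using assms that profile_mid[OF that, of Bm Bp] by (simp add: tw_coefficients_def mid_V_def)
  have 0: "Bm - Bm' = Bp' - Bp" using eq[of 0] pos by simp
  have "(Bm - Bm') * exp (mm * \<Xi>) = (Bp' - Bp) * exp (mp * \<Xi>)"
    using eq[of \<Xi>] pos by (simp add: algebra_simps)
  then have "(Bp' - Bp) * (exp (mm * \<Xi>) - exp (mp * \<Xi>)) = 0"
    unfolding 0 by (simp add: algebra_simps)
  moreover have "exp (mm * \<Xi>) \<noteq> exp (mp * \<Xi>)" using rates_interlace(5) pos by simp
  ultimately show "Bp' = Bp" by simp
  with 0 show "Bm' = Bm" by simp
qed

lemma profile_solution_iff:
  "tw_solution \<nu> \<kappa> S \<Xi> (profile_V Bm Bp) \<longleftrightarrow>
     (\<forall>X. profile_V Bm Bp X \<ge> 0) \<and> integral {-\<Xi>..\<Xi>} (mid_V Bm Bp) = 2 * \<kappa>"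
proof -
  have "integral {-\<Xi>..\<Xi>} (profile_V Bm Bp) = integral {-\<Xi>..\<Xi>} (mid_V Bm Bp)"
    by (rule integral_cong) (rule profile_mid)
  moreover have "weak_tw_equation \<nu> \<kappa> S \<Xi> (profile_V Bm Bp)"
    by (rule weak_tw_equation_of_flux[OF continuous_profile(1) profile_flux]) (use pos in auto)
  ultimately show ?thesis by (simp add: tw_solution_def continuous_profile)
qed

lemma solution_is_profile:
  assumes "tw_solution \<nu> \<kappa> S \<Xi> V"
  obtains Bm Bp where "V = profile_V Bm Bp"
proof -
  have V: "continuous_on UNIV V" "weak_tw_equation \<nu> \<kappa> S \<Xi> V"
    using assms by (auto simp: tw_solution_def)
  obtain Q where "tw_flux \<nu> \<kappa> S \<Xi> V Q"
    by (rule flux_of_weak_tw_equation[OF V]) (use pos in auto)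
  then show thesis using flux_is_profile[OF V(1)] that by blast
qed

text \<open>Exponentials with different rates are linearly independent on \<open>I\<^sub>0\<close>, so the coefficients in the
  definition of the ratio are those of the profile.\<close>
lemma ratio_iff:
  "tw_solution_ratio \<nu> \<kappa> S \<Xi> \<sigma> V \<longleftrightarrow>
     tw_solution \<nu> \<kappa> S \<Xi> V \<and> (\<exists>B > 0. V = profile_V (\<sigma> * B) B)"
proof
  assume ratio: "tw_solution_ratio \<nu> \<kappa> S \<Xi> \<sigma> V"
  then obtain Am Ap Bm Bp Cm Cp where sol: "tw_solution \<nu> \<kappa> S \<Xi> V"
    and co: "tw_coefficients \<nu> \<kappa> S \<Xi> V Am Ap Bm Bp Cm Cp" "Bm = \<sigma> * Bp" "Bp > 0"
    unfolding tw_solution_ratio_def by blast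
  obtain Bm' Bp' where V: "V = profile_V Bm' Bp'" using solution_is_profile[OF sol] by blast
  have "Bm = Bm'" "Bp = Bp'" using mid_coefficients_unique[OF co(1)[unfolded V]] by auto
  then show "tw_solution \<nu> \<kappa> S \<Xi> V \<and> (\<exists>B > 0. V = profile_V (\<sigma> * B) B)" using sol V co by auto
next
  assume "tw_solution \<nu> \<kappa> S \<Xi> V \<and> (\<exists>B > 0. V = profile_V (\<sigma> * B) B)"
  then show "tw_solution_ratio \<nu> \<kappa> S \<Xi> \<sigma> V"
    unfolding tw_solution_ratio_def using profile_coefficients by blast
qed

lemma integral_mid_scale: "integral {-\<Xi>..\<Xi>} (mid_V (\<sigma> * B) B) = B * integral {-\<Xi>..\<Xi>} (mid_V \<sigma> 1)"
proof -
  have "mid_V (\<sigma> * B) B = (\<lambda>X. B * mid_V \<sigma> 1 X)" by (auto simp: mid_V_def algebra_simps)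
  then show ?thesis by simp
qed

lemma integral_mid_pos:
  assumes "sigma_min \<le> \<sigma>"
  shows "integral {-\<Xi>..\<Xi>} (mid_V \<sigma> 1) > 0"
proof -
  have p: "mid_V \<sigma> 1 X > 0" if "X \<in> {-\<Xi>..\<Xi>}" for X
    by (rule mid_pos) (use assms that in auto)
  have "integral {-\<Xi>..\<Xi>} (mid_V \<sigma> 1) \<ge> 0"
    by (rule integral_nonneg[OF integrable_continuous_real[OF continuous_mid(1)]]) (use p in force)
  moreover have "integral {-\<Xi>..\<Xi>} (mid_V \<sigma> 1) \<noteq> 0"
    using integral_eq_0_iff[OF continuous_mid(1)[of "{-\<Xi>..\<Xi>}"], of \<sigma> 1] p[of 0] p pos
    by (force simp: less_imp_le)
  ultimately show ?thesis by simp
qed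

text \<open>For a fixed ratio the profile is linear in \<open>B\<^sub>+\<close>, and the integral constraint selects
  one value of it, positive since \<open>mid_V \<sigma> 1\<close> is positive on \<open>I\<^sub>0\<close>.\<close>
lemma ratio_solution_iff:
  assumes \<sigma>: "sigma_min \<le> \<sigma>" "\<sigma> \<le> sigma_max"
  defines "B \<equiv> 2 * \<kappa> / integral {-\<Xi>..\<Xi>} (mid_V \<sigma> 1)"
  shows "tw_solution_ratio \<nu> \<kappa> S \<Xi> \<sigma> V \<longleftrightarrow> V = profile_V (\<sigma> * B) B" and "B > 0"
proof -
  note I = integral_mid_pos[OF \<sigma>(1)]
  show "B > 0" unfolding B_def using I pos by simp
  have nonneg: "profile_V (\<sigma> * C) C X \<ge> 0" if "C > 0" for C X
    using that by (intro less_imp_le profile_pos mult_right_mono[OF \<sigma>(1)] mult_right_mono[OF \<sigma>(2)]) auto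
  have "C * integral {-\<Xi>..\<Xi>} (mid_V \<sigma> 1) = 2 * \<kappa> \<longleftrightarrow> C = B" for C
    unfolding B_def using I by (auto simp: field_simps)
  then show "tw_solution_ratio \<nu> \<kappa> S \<Xi> \<sigma> V \<longleftrightarrow> V = profile_V (\<sigma> * B) B"
    unfolding ratio_iff using \<open>B > 0\<close> nonneg
    by (auto simp: profile_solution_iff integral_mid_scale)
qed

lemma outer_coefficients_nonneg:
  assumes V: "\<And>X. V X \<ge> 0" and co: "tw_coefficients \<nu> \<kappa> S \<Xi> V Am Ap Bm Bp Cm Cp"
  shows "Am \<ge> 0" "Cp \<ge> 0"
proof -
  have rates: "lm < lp" using lambda_relations by simp
  show "Am \<ge> 0"
  proof (rule slow_coefficient_nonneg[OF rates, of "-\<Xi>"])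
    show "Am * exp (lm * X) + Ap * exp (lp * X) \<ge> 0" if "X \<le> - \<Xi>" for X
      using co V[of X] that by (simp add: tw_coefficients_def)
  qed
  show "Cp \<ge> 0"
  proof (rule fast_coefficient_nonneg[OF rates, of \<Xi>])
    show "Cm * exp (lm * X) + Cp * exp (lp * X) \<ge> 0" if "X \<ge> \<Xi>" for X
      using co V[of X] that by (simp add: tw_coefficients_def)
  qed
qed

text \<open>Nonnegativity on both half-lines confines \<open>B\<^sub>-\<close> between \<open>sigma_min B\<^sub>+\<close> and \<open>sigma_max B\<^sub>+\<close>. As
  \<open>sigma_min < 0 < sigma_max\<close>, this forces \<open>B\<^sub>+ \<ge> 0\<close>, with equality only for the zero profile, which the
  integral constraint excludes.\<close>
lemma solution_has_ratio:
  assumes sol: "tw_solution \<nu> \<kappa> S \<Xi> V"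
  obtains \<sigma> where "sigma_min \<le> \<sigma>" "\<sigma> \<le> sigma_max" "tw_solution_ratio \<nu> \<kappa> S \<Xi> \<sigma> V"
proof -
  obtain Bm Bp where V: "V = profile_V Bm Bp" using solution_is_profile[OF sol] by blast
  have int: "integral {-\<Xi>..\<Xi>} (mid_V Bm Bp) = 2 * \<kappa>" and nonneg: "\<And>X. profile_V Bm Bp X \<ge> 0"
    using sol unfolding V profile_solution_iff by auto
  note bounds = profile_nonneg_imp[OF nonneg]
  have "Bp > 0"
  proof (rule ccontr)
    assume "\<not> Bp > 0"
    moreover have "0 \<le> (sigma_max - sigma_min) * Bp" using bounds by (simp only: left_diff_distrib)
    then have "0 \<le> Bp" using sigma_min_neg sigma_max_pos by (simp only: zero_le_mult_iff) linarith
    ultimately have "Bp = 0" by simp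
    then have "Bm = 0" using bounds by simp
    with \<open>Bp = 0\<close> have "mid_V Bm Bp = (\<lambda>_. 0)" by (auto simp: mid_V_def)
    then show False using int pos by simp
  qed
  then have "sigma_min \<le> Bm / Bp" "Bm / Bp \<le> sigma_max"
    using bounds by (simp_all only: pos_le_divide_eq pos_divide_le_eq)
  moreover have "tw_solution_ratio \<nu> \<kappa> S \<Xi> (Bm / Bp) V"
    unfolding ratio_iff using sol V \<open>Bp > 0\<close> by auto
  ultimately show thesis by (rule that)
qed

end

theorem theorem2:
  fixes \<nu> \<kappa> S \<Xi> :: real
  assumes "\<nu> > 0" and "0 < \<kappa>" and "\<kappa> < 1" and "S > 0" and "\<Xi> > 0"
  shows "(\<forall>\<sigma>\<in>sigma_range \<nu> \<kappa> S \<Xi>.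
            (\<exists>!V. tw_solution_ratio \<nu> \<kappa> S \<Xi> \<sigma> V) \<and>
            (\<forall>V. tw_solution_ratio \<nu> \<kappa> S \<Xi> \<sigma> V \<longrightarrow>
               (\<forall>X. V X > 0) \<and>
               (\<forall>Am Ap Bm Bp Cm Cp. tw_coefficients \<nu> \<kappa> S \<Xi> V Am Ap Bm Bp Cm Cp \<longrightarrow>
                  Am \<ge> 0 \<and> Cp \<ge> 0))) \<and>
         (\<forall>V. tw_solution \<nu> \<kappa> S \<Xi> V \<longrightarrow>
            (\<exists>\<sigma>\<in>sigma_range \<nu> \<kappa> S \<Xi>. tw_solution_ratio \<nu> \<kappa> S \<Xi> \<sigma> V))"
proof -
  interpret tw_parameters \<nu> \<kappa> S \<Xi> by unfold_locales (fact assms)+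
  show ?thesis
  proof (intro conjI ballI allI impI)
    fix \<sigma> assume "\<sigma> \<in> sigma_range \<nu> \<kappa> S \<Xi>"
    then have \<sigma>: "sigma_min \<le> \<sigma>" "\<sigma> \<le> sigma_max" by (auto simp: sigma_range_eq)
    note ratio = ratio_solution_iff[OF \<sigma>]
    show "\<exists>!V. tw_solution_ratio \<nu> \<kappa> S \<Xi> \<sigma> V" unfolding ratio(1) by simp
    fix V assume V: "tw_solution_ratio \<nu> \<kappa> S \<Xi> \<sigma> V"
    show "V X > 0" for X
      unfolding V[unfolded ratio(1)]
      using ratio(2) by (intro profile_pos mult_right_mono[OF \<sigma>(1)] mult_right_mono[OF \<sigma>(2)]) auto
    then have nonneg: "V X \<ge> 0" for X by (rule less_imp_le)
    fix Am Ap Bm Bp Cm Cp assume "tw_coefficients \<nu> \<kappa> S \<Xi> V Am Ap Bm Bp Cm Cp"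
    then show "Am \<ge> 0" "Cp \<ge> 0" using outer_coefficients_nonneg[OF nonneg] by auto
  next
    fix V assume "tw_solution \<nu> \<kappa> S \<Xi> V"
    then show "\<exists>\<sigma>\<in>sigma_range \<nu> \<kappa> S \<Xi>. tw_solution_ratio \<nu> \<kappa> S \<Xi> \<sigma> V"
      by (rule solution_has_ratio) (auto simp: sigma_range_eq)
  qed
qed

end
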